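(* Let $(\Omega,\mathsf{F})$ be a measurable space and let $(\mathcal{H},d)$ be a separable Hadamard space. Let $\mathcal{P}$ be a collection of probability measures on $(\Omega,\mathsf{F})$ and let $(X_i)_{i\ge1}$ be a sequence of $\mathcal{H}$-valued random variables on $(\Omega,\mathsf{F})$ which is i.i.d. under every $\mathbb{P}\in\mathcal{P}$. Suppose that $X_1$ is $\mathcal{P}$-uniformly integrable, i.e. \[ \lim_{x\to\infty}\sup_{\mathbb{P}\in\mathcal{P}}\mathbb{E}_{\mathbb{P}}[d(o,X_1)\mathbf{1}_{d(o,X_1)\ge x}]=0 \] for a fixed $o\in\mathcal{H}$. Then for every $\varepsilon>0$, \[ \lim_{m\to\infty}\sup_{\mathbb{P}\in\mathcal{P}}\mathbb{P}\left(\sup_{n\ge m}d\left(s_n,\mathbb{E}_{\mathbb{P}}[X_1]\right)>\varepsilon\right)=0, \] where $s_n$ is the $n$-th inductive mean of $X_1,\dots,X_n$.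
   Context: A Hadamard space is a complete metric space $(\mathcal{H},d)$ in which any two points are joined by a geodesic (an isometric embedding $\gamma:[0,l]\to\mathcal{H}$) and such that $d^2(\gamma(tl),x)\le(1-t)d^2(\gamma(0),x)+td^2(\gamma(l),x)-t(1-t)d^2(\gamma(0),\gamma(l))$ for all $x\in\mathcal{H}$, $t\in[0,1]$ and all geodesics $\gamma:[0,l]\to\mathcal{H}$. Geodesics between two points are unique, and $(1-t)x\oplus ty$ denotes the point $\gamma(tl)$ on the geodesic $\gamma:[0,l]\to\mathcal{H}$ with $\gamma(0)=x$, $\gamma(l)=y$. $\mathcal{H}$-valued random variables are Borel measurable maps. For a random variable $X$ with $\mathbb{E}_{\mathbb{P}}[d(X,z)]<\infty$ for some/any $z\in\mathcal{H}$, the expectation is the barycenter of its distribution under $\mathbb{P}$: $\mathbb{E}_{\mathbb{P}}[X]:=\mathrm{argmin}_{z\in\mathcal{H}}\mathbb{E}_{\mathbb{P}}[d^2(z,X)-d^2(y,X)]$, a unique point that is independent of $y\in\mathcal{H}$. The inductive means of a sequence $(x_i)\subseteq\mathcal{H}$ are $s_1:=x_1$ and $s_n:=(1-\frac1n)s_{n-1}\oplus\frac1n x_n$. *)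

theory Defs
  imports "HOL-Probability.Probability"
begin

definition (in metric_space) geodesic :: "real \<Rightarrow> (real \<Rightarrow> 'a) \<Rightarrow> bool" where
  "geodesic l \<gamma> \<longleftrightarrow> 0 \<le> l \<and> (\<forall>s\<in>{0..l}. \<forall>t\<in>{0..l}. dist (\<gamma> s) (\<gamma> t) = \<bar>s - t\<bar>)"

class hadamard_space = complete_space +
  assumes ex_geodesic: "\<exists>l \<gamma>. geodesic l \<gamma> \<and> \<gamma> 0 = x \<and> \<gamma> l = y"
    and geodesic_dist_le: "\<lbrakk>geodesic l \<gamma>; 0 \<le> t; t \<le> 1\<rbrakk> \<Longrightarrow>
      (dist (\<gamma> (t * l)) x)\<^sup>2 \<le>
        (1 - t) * (dist (\<gamma> 0) x)\<^sup>2 + t * (dist (\<gamma> l) x)\<^sup>2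
          - t * (1 - t) * (dist (\<gamma> 0) (\<gamma> l))\<^sup>2"

class separable_hadamard_space = hadamard_space +
  assumes separable: "\<exists>D. countable D \<and> closure D = UNIV"

instance separable_hadamard_space \<subseteq> second_countable_topology
proof
  obtain D :: "'a set" where D: "countable D" "closure D = UNIV"
    using separable by blast
  define B where "B = (\<lambda>(x, n). ball x (1 / real (Suc n))) ` (D \<times> (UNIV :: nat set))"
  have "countable B"
    unfolding B_def using D(1) by auto
  moreover have "topological_basis B"
  proof (rule topological_basisI)
    show "open U" if "U \<in> B" for U
      using that by (auto simp: B_def)
    show "\<exists>V\<in>B. x \<in> V \<and> V \<subseteq> U" if U: "open U" "x \<in> U" for U x
    proof -
      obtain e where e: "e > 0" "ball x e \<subseteq> U"
        using U by (meson open_contains_ball)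
      obtain n where n: "1 / real (Suc n) < e / 2"
        using nat_approx_posE[of "e / 2"] e(1) by auto
      have "x \<in> closure D"
        using D(2) by simp
      then obtain y where y: "y \<in> D" "dist y x < 1 / real (Suc n)"
        by (metis closure_approachable of_nat_0_less_iff zero_less_Suc zero_less_divide_1_iff)
      have "ball y (1 / real (Suc n)) \<subseteq> ball x e"
      proof
        fix z assume "z \<in> ball y (1 / real (Suc n))"
        then have "dist x z < e"
          using dist_triangle[of x z y] y(2) n by (simp add: dist_commute)
        then show "z \<in> ball x e" by simp
      qed
      then show ?thesis
        using y e(2) by (intro bexI[of _ "ball y (1 / real (Suc n))"]) (auto simp: B_def)
    qed
  qed
  ultimately show "\<exists>B :: 'a set set. countable B \<and> open = generate_topology B"
    using topological_basis_imp_subbasis by blast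
qed

text \<open>The point \<open>(1 - t) x \<oplus> t y\<close>.\<close>
definition geodesic_point :: "real \<Rightarrow> 'a \<Rightarrow> 'a \<Rightarrow> 'a::metric_space" where
  "geodesic_point t x y =
     (THE p. \<exists>l \<gamma>. geodesic l \<gamma> \<and> \<gamma> 0 = x \<and> \<gamma> l = y \<and> p = \<gamma> (t * l))"

lemma geodesic_point_eq:
  fixes \<gamma> :: "real \<Rightarrow> 'a::hadamard_space"
  assumes "geodesic l \<gamma>" and t: "0 \<le> t" "t \<le> 1"
  shows "geodesic_point t (\<gamma> 0) (\<gamma> l) = \<gamma> (t * l)"
  unfolding geodesic_point_def
proof (rule the_equality)
  show "\<exists>l' \<gamma>'. geodesic l' \<gamma>' \<and> \<gamma>' 0 = \<gamma> 0 \<and> \<gamma>' l' = \<gamma> l \<and> \<gamma> (t * l) = \<gamma>' (t * l')"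
    using assms by blast
  fix p assume "\<exists>l' \<gamma>'. geodesic l' \<gamma>' \<and> \<gamma>' 0 = \<gamma> 0 \<and> \<gamma>' l' = \<gamma> l \<and> p = \<gamma>' (t * l')"
  then obtain l' \<gamma>' where g: "geodesic l' \<gamma>'" "\<gamma>' 0 = \<gamma> 0" "\<gamma>' l' = \<gamma> l" "p = \<gamma>' (t * l')"
    by blast
  have l: "0 \<le> l" "dist (\<gamma> 0) (\<gamma> l) = l"
    using assms(1) by (auto simp: geodesic_def)
  moreover have "0 \<le> l'" "dist (\<gamma>' 0) (\<gamma>' l') = l'"
    using g(1) by (auto simp: geodesic_def)
  ultimately have l': "l' = l"
    using g by simp
  have tl: "0 \<le> t * l" "t * l \<le> l"
    using t l by (auto simp: mult_left_le_one_le)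
  have "dist (\<gamma>' 0) (\<gamma>' (t * l)) = t * l" "dist (\<gamma>' l) (\<gamma>' (t * l)) = l - t * l"
    using g(1) tl l(1) unfolding l' geodesic_def by auto
  then have d: "dist (\<gamma> 0) p = t * l" "dist (\<gamma> l) p = (1 - t) * l"
    using g(2-4) unfolding l' by (simp_all add: algebra_simps)
  have "(dist (\<gamma> (t * l)) p)\<^sup>2 \<le> (1 - t) * (t * l)\<^sup>2 + t * ((1 - t) * l)\<^sup>2 - t * (1 - t) * l\<^sup>2"
    using geodesic_dist_le[OF assms, of p] d l(2) by simp
  also have "\<dots> = 0"
    by (simp add: power2_eq_square algebra_simps)
  finally show "p = \<gamma> (t * l)"
    by simp
qed

text \<open>The value at \<open>0\<close> is unspecified: both the sequence and its means are indexed from \<open>1\<close>.\<close>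
fun inductive_mean :: "(nat \<Rightarrow> 'a::metric_space) \<Rightarrow> nat \<Rightarrow> 'a" where
  "inductive_mean x 0 = undefined"
| "inductive_mean x (Suc 0) = x 1"
| "inductive_mean x (Suc (Suc n)) =
     geodesic_point (1 / real (Suc (Suc n))) (inductive_mean x (Suc n)) (x (Suc (Suc n)))"

text \<open>
  The barycenter of the distribution of \<open>X\<close>. When \<open>X\<close> has a finite first moment, the integrand is
  integrable for all \<open>y\<close> and \<open>z\<close>, and changing \<open>y\<close> shifts the functional by a constant.
\<close>
definition barycenter :: "'w measure \<Rightarrow> ('w \<Rightarrow> 'a::metric_space) \<Rightarrow> 'a" where
  "barycenter P X =
     (THE b. \<forall>y. is_arg_min (\<lambda>z. \<integral>\<omega>. (dist z (X \<omega>))\<^sup>2 - (dist y (X \<omega>))\<^sup>2 \<partial>P) (\<lambda>_. True) b)"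

definition iid :: "'w measure \<Rightarrow> (nat \<Rightarrow> 'w \<Rightarrow> 'a::topological_space) \<Rightarrow> bool" where
  "iid P X \<longleftrightarrow> prob_space.indep_vars P (\<lambda>_. borel) X {1..} \<and>
     (\<forall>i\<ge>1. distr P borel (X i) = distr P borel (X 1))"

text \<open>Suprema and integrals are taken in \<^typ>\<open>ennreal\<close>, so that an infinite expectation counts as \<open>\<infinity>\<close>.\<close>
definition uniformly_integrable_wrt ::
  "'w measure set \<Rightarrow> 'a::metric_space \<Rightarrow> ('w \<Rightarrow> 'a) \<Rightarrow> bool" where
  "uniformly_integrable_wrt \<P> p X \<longleftrightarrow>
     ((\<lambda>x::real. \<Squnion>P\<in>\<P>. \<integral>\<^sup>+\<omega>. ennreal (dist p (X \<omega>)) * indicator {\<omega>. dist p (X \<omega>) \<ge> x} \<omega> \<partial>P)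
        \<longlongrightarrow> 0) at_top"

end

theory Submission
  imports Defs
begin

text \<open>
  Replace \<open>X\<^sub>i\<close> by \<open>Y\<^sub>i\<close>, which agrees with \<open>X\<^sub>i\<close> on \<open>d(p, X\<^sub>i) < K\<close> and equals \<open>p\<close> elsewhere. Since the
  distance is convex along geodesics, the inductive means of \<open>X\<close> and \<open>Y\<close> differ by at most the
  average of the \<open>d(X\<^sub>i, Y\<^sub>i)\<close>, and the maximal ergodic inequality bounds the probability that any of
  these averages exceeds \<open>\<epsilon> / 3\<close> by \<open>3 E[d(X\<^sub>1, Y\<^sub>1)] / \<epsilon>\<close>, which is uniformly small for large \<open>K\<close>.
  The variance inequality shows that the barycenters of \<open>X\<^sub>1\<close> and \<open>Y\<^sub>1\<close> are close as well. For the
  bounded variables \<open>Y\<^sub>i\<close>, Sturm's estimate \<open>E[d(s\<^sub>n, b)\<^sup>2] \<le> V / n\<close> makes the deviation probabilities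
  summable along \<open>n = k\<^sup>2\<close>, uniformly in the measure, and between consecutive squares the means
  move by \<open>O(K / k)\<close>.
\<close>

section \<open>Geodesics and inductive means\<close>

text \<open>The form in which the curvature condition is used from here on. Apart from the distances
  to the two endpoints, nothing else about geodesics is needed later.\<close>

lemma geodesic_point_dist_le:
  fixes x y z :: "'a::hadamard_space"
  assumes t: "0 \<le> t" "t \<le> 1"
  shows "(dist (geodesic_point t x y) z)\<^sup>2 \<le>
    (1 - t) * (dist x z)\<^sup>2 + t * (dist y z)\<^sup>2 - t * (1 - t) * (dist x y)\<^sup>2"
proof -
  obtain l \<gamma> where g: "geodesic l \<gamma>" "\<gamma> 0 = x" "\<gamma> l = y"
    using ex_geodesic by blast
  show ?thesis
    using geodesic_dist_le[OF g(1) t, of z] geodesic_point_eq[OF g(1) t] g(2,3) by simp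
qed

lemma dist_geodesic_point:
  fixes x y :: "'a::hadamard_space"
  assumes t: "0 \<le> t" "t \<le> 1"
  shows dist_geodesic_point_left: "dist x (geodesic_point t x y) = t * dist x y"
    and dist_geodesic_point_right: "dist y (geodesic_point t x y) = (1 - t) * dist x y"
proof -
  obtain l \<gamma> where g: "geodesic l \<gamma>" "\<gamma> 0 = x" "\<gamma> l = y"
    using ex_geodesic by blast
  have l: "0 \<le> l" and iso: "\<And>s t. s \<in> {0..l} \<Longrightarrow> t \<in> {0..l} \<Longrightarrow> dist (\<gamma> s) (\<gamma> t) = \<bar>s - t\<bar>"
    using g(1) by (auto simp: geodesic_def)
  have tl: "0 \<le> t * l" "t * l \<le> l"
    using t l by (auto simp: mult_left_le_one_le)
  have xy: "dist x y = l"
    using iso[of 0 l] g l by auto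
  have p: "geodesic_point t x y = \<gamma> (t * l)"
    using geodesic_point_eq[OF g(1) t] g by simp
  show "dist x (geodesic_point t x y) = t * dist x y"
    using iso[of 0 "t * l"] tl l xy p g by auto
  show "dist y (geodesic_point t x y) = (1 - t) * dist x y"
    using iso[of l "t * l"] tl l xy p g by (auto simp: algebra_simps)
qed

text \<open>Closed balls are geodesically convex: drop the nonnegative term t(1-t)d(x,y)^2 from the
  curvature inequality.\<close>

lemma dist_geodesic_point_le:
  fixes x y z :: "'a::hadamard_space"
  assumes t: "0 \<le> t" "t \<le> 1" and "dist z x \<le> K" "dist z y \<le> K"
  shows "dist z (geodesic_point t x y) \<le> K"
proof (rule power2_le_imp_le)
  show K: "0 \<le> K"
    using assms(3) zero_le_dist order_trans by blast
  have "(dist z (geodesic_point t x y))\<^sup>2 \<le> (1 - t) * (dist x z)\<^sup>2 + t * (dist y z)\<^sup>2 - t * (1 - t) * (dist x y)\<^sup>2"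
    using geodesic_point_dist_le[OF t, of x y z] by (simp add: dist_commute)
  also have "\<dots> \<le> (1 - t) * K\<^sup>2 + t * K\<^sup>2 - 0"
    using assms by (intro diff_mono add_mono mult_left_mono power_mono) (auto simp: dist_commute)
  finally show "(dist z (geodesic_point t x y))\<^sup>2 \<le> K\<^sup>2"
    by (simp add: algebra_simps)
qed

text \<open>The curvature inequality is applied twice: to the point on the side from x to z against
  p, then to p against z. The terms with d(x,y) and d(x,z) cancel and only t^2 d(y,z)^2
  remains.\<close>

lemma dist_geodesic_point_same_left:
  fixes x y z :: "'a::hadamard_space"
  assumes t: "0 \<le> t" "t \<le> 1"
  shows "dist (geodesic_point t x y) (geodesic_point t x z) \<le> t * dist y z"
proof (rule power2_le_imp_le)
  define p q where "p = geodesic_point t x y" and "q = geodesic_point t x z"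
  have 1: "(dist q p)\<^sup>2 \<le> (1 - t) * (dist x p)\<^sup>2 + t * (dist z p)\<^sup>2 - t * (1 - t) * (dist x z)\<^sup>2"
    unfolding q_def by (rule geodesic_point_dist_le[OF t])
  have 2: "(dist z p)\<^sup>2 \<le> (1 - t) * (dist x z)\<^sup>2 + t * (dist y z)\<^sup>2 - t * (1 - t) * (dist x y)\<^sup>2"
    using geodesic_point_dist_le[OF t, of x y z] by (simp add: p_def dist_commute)
  have 3: "dist x p = t * dist x y"
    unfolding p_def by (rule dist_geodesic_point_left[OF t])
  have "(dist q p)\<^sup>2 \<le> (1 - t) * (t * dist x y)\<^sup>2 + t * ((1 - t) * (dist x z)\<^sup>2 + t * (dist y z)\<^sup>2
      - t * (1 - t) * (dist x y)\<^sup>2) - t * (1 - t) * (dist x z)\<^sup>2"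
    using 1 mult_left_mono[OF 2 t(1)] unfolding 3 by linarith
  also have "\<dots> = (t * dist y z)\<^sup>2"
    by (simp add: power2_eq_square algebra_simps)
  finally show "(dist p q)\<^sup>2 \<le> (t * dist y z)\<^sup>2"
    by (simp add: dist_commute)
qed (use t in auto)

text \<open>No geodesic is reversed: the right-hand point has distances t d(x,y) to x and
  (1-t)d(x,y) to y, and with these values the curvature inequality forces its distance from the
  left-hand point to be zero.\<close>

lemma geodesic_point_commute:
  fixes x y :: "'a::hadamard_space"
  assumes t: "0 \<le> t" "t \<le> 1"
  shows "geodesic_point t x y = geodesic_point (1 - t) y x"
proof -
  let ?p = "geodesic_point (1 - t) y x"
  have "(dist (geodesic_point t x y) ?p)\<^sup>2
      \<le> (1 - t) * (t * dist x y)\<^sup>2 + t * ((1 - t) * dist x y)\<^sup>2 - t * (1 - t) * (dist x y)\<^sup>2"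
    using geodesic_point_dist_le[OF t, of x y ?p] dist_geodesic_point_left[of "1 - t" y x]
      dist_geodesic_point_right[of "1 - t" x y] t
    by (simp add: dist_commute[of y x])
  also have "\<dots> = 0"
    by (simp add: power2_eq_square algebra_simps)
  finally show ?thesis
    by simp
qed

text \<open>Insert the point between x and y'. Each of the two resulting pairs shares an endpoint,
  after reversing orientation for the second pair.\<close>

lemma dist_geodesic_point_geodesic_point:
  fixes x y :: "'a::hadamard_space"
  assumes t: "0 \<le> t" "t \<le> 1"
  shows "dist (geodesic_point t x y) (geodesic_point t x' y') \<le> (1 - t) * dist x x' + t * dist y y'"
proof -
  have "dist (geodesic_point t x y) (geodesic_point t x y') \<le> t * dist y y'"
    by (rule dist_geodesic_point_same_left[OF t])
  moreover have "dist (geodesic_point t x y') (geodesic_point t x' y') \<le> (1 - t) * dist x x'"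
    using dist_geodesic_point_same_left[of "1 - t" y' x x'] t
    by (simp add: geodesic_point_commute[OF t])
  ultimately show ?thesis
    using dist_triangle[of "geodesic_point t x y" "geodesic_point t x' y'" "geodesic_point t x y'"]
    by linarith
qed

lemma continuous_on_geodesic_point:
  assumes t: "0 \<le> t" "t \<le> 1"
  shows "continuous_on UNIV (\<lambda>z::'a::hadamard_space \<times> 'a. geodesic_point t (fst z) (snd z))"
proof (rule continuous_at_imp_continuous_on, intro ballI)
  fix z :: "'a \<times> 'a"
  show "isCont (\<lambda>z. geodesic_point t (fst z) (snd z)) z"
    unfolding isCont_def
  proof (rule tendstoI)
    fix e :: real assume "e > 0"
    have "((\<lambda>w. (1 - t) * dist (fst w) (fst z) + t * dist (snd w) (snd z)) \<longlongrightarrow>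
        (1 - t) * dist (fst z) (fst z) + t * dist (snd z) (snd z)) (at z)"
      by (intro tendsto_intros)
    then have "\<forall>\<^sub>F w in at z. (1 - t) * dist (fst w) (fst z) + t * dist (snd w) (snd z) < e"
      using \<open>e > 0\<close> by (intro order_tendstoD) auto
    then show "\<forall>\<^sub>F w in at z. dist (geodesic_point t (fst w) (snd w)) (geodesic_point t (fst z) (snd z)) < e"
      by eventually_elim (rule le_less_trans[OF dist_geodesic_point_geodesic_point[OF t]])
  qed
qed

section \<open>Inductive means: dependence on the sequence, size of increments,
  measurability\<close>

lemma inductive_mean_Suc:
  "n \<ge> 1 \<Longrightarrow> inductive_mean x (Suc n) =
     geodesic_point (1 / real (Suc n)) (inductive_mean x n) (x (Suc n))"
  by (cases n) auto

lemma inductive_mean_cong: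
  "n \<ge> 1 \<Longrightarrow> (\<And>i. 1 \<le> i \<Longrightarrow> i \<le> n \<Longrightarrow> x i = y i) \<Longrightarrow> inductive_mean x n = inductive_mean y n"
  by (induction n rule: nat_induct_at_least) (auto simp: inductive_mean_Suc)

text \<open>Multiplied by n + 1, the convexity bound for one step has the coefficient (n+1)(1 -
  1/(n+1)) = n on the old distance, so the recursion telescopes. The shift \<open>Suc i\<close>
  turns the range below n into the indices 1 to n.\<close>

lemma dist_inductive_mean_le_sum:
  fixes x y :: "nat \<Rightarrow> 'a::hadamard_space"
  assumes "n \<ge> 1"
  shows "real n * dist (inductive_mean x n) (inductive_mean y n) \<le> (\<Sum>i<n. dist (x (Suc i)) (y (Suc i)))"
  using assms
proof (induction n rule: nat_induct_at_least)
  case (Suc n)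
  have "dist (inductive_mean x (Suc n)) (inductive_mean y (Suc n))
      \<le> (1 - 1 / real (Suc n)) * dist (inductive_mean x n) (inductive_mean y n)
        + 1 / real (Suc n) * dist (x (Suc n)) (y (Suc n))"
    unfolding inductive_mean_Suc[OF Suc.hyps]
    by (rule dist_geodesic_point_geodesic_point) auto
  from mult_left_mono[OF this, of "real (Suc n)"]
  have "real (Suc n) * dist (inductive_mean x (Suc n)) (inductive_mean y (Suc n))
      \<le> real n * dist (inductive_mean x n) (inductive_mean y n) + dist (x (Suc n)) (y (Suc n))"
    by (simp only: distrib_left mult.assoc[symmetric] right_diff_distrib) simp
  with Suc.IH show ?case by simp
qed auto

lemma inductive_mean_in_cball:
  fixes x :: "nat \<Rightarrow> 'a::hadamard_space"
  assumes "n \<ge> 1" "\<And>i. i \<ge> 1 \<Longrightarrow> dist z (x i) \<le> K"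
  shows "dist z (inductive_mean x n) \<le> K"
  using assms(1)
proof (induction n rule: nat_induct_at_least)
  case (Suc n)
  then show ?case
    using assms(2) by (simp add: inductive_mean_Suc dist_geodesic_point_le)
qed (use assms in auto)

text \<open>Step n + 1 moves the mean by 1/(n+1) times its distance to the new point. Both lie in
  the ball of radius K around z, so every step after j has length at most 2K/j.\<close>

lemma dist_inductive_mean_add_le:
  fixes x :: "nat \<Rightarrow> 'a::hadamard_space"
  assumes j: "j \<ge> 1" and x: "\<And>i. i \<ge> 1 \<Longrightarrow> dist z (x i) \<le> K"
  shows "dist (inductive_mean x j) (inductive_mean x (j + i)) \<le> real i * (2 * K / real j)"
proof (induction i)
  case (Suc i)
  have "K \<ge> 0"
    using x[of 1] zero_le_dist order_trans by (metis order_refl)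
  have "dist (inductive_mean x (j + i)) (inductive_mean x (Suc (j + i)))
     = 1 / real (Suc (j + i)) * dist (inductive_mean x (j + i)) (x (Suc (j + i)))"
    using j by (simp only: inductive_mean_Suc trans_le_add1) (rule dist_geodesic_point_left, auto)
  also have "\<dots> \<le> 1 / real (Suc (j + i)) * (2 * K)"
  proof (rule mult_left_mono)
    show "dist (inductive_mean x (j + i)) (x (Suc (j + i))) \<le> 2 * K"
      using x[of "Suc (j + i)"] inductive_mean_in_cball[where x=x and n="j + i" and z=z and K=K] x j
        dist_triangle3[of "inductive_mean x (j + i)" "x (Suc (j + i))" z] by fastforce
  qed auto
  also have "\<dots> \<le> 2 * K / real j"
    using j \<open>K \<ge> 0\<close> by (auto intro!: frac_le)
  finally show ?case
    using Suc.IH dist_triangle[of "inductive_mean x j" "inductive_mean x (Suc (j + i))" "inductive_mean x (j + i)"]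
    by (simp add: algebra_simps add_divide_distrib)
qed auto

text \<open>Each step applies a jointly continuous map to a pair of measurable maps. Separability
  makes such a composition Borel measurable.\<close>

lemma borel_measurable_inductive_mean:
  fixes X :: "nat \<Rightarrow> 'w \<Rightarrow> 'a::separable_hadamard_space"
  assumes "n \<ge> 1" "\<And>i. 1 \<le> i \<Longrightarrow> i \<le> n \<Longrightarrow> X i \<in> borel_measurable M"
  shows "(\<lambda>\<omega>. inductive_mean (\<lambda>i. X i \<omega>) n) \<in> borel_measurable M"
  using assms
proof (induction n rule: nat_induct_at_least)
  case (Suc n)
  show ?case
    unfolding inductive_mean_Suc[OF Suc.hyps]
    by (rule borel_measurable_continuous_Pair[OF Suc.IH[OF Suc.prems] Suc.prems
          continuous_on_geodesic_point]) (use Suc.hyps in simp_all)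
qed simp

section \<open>Barycenters\<close>

text \<open>Factor the difference of squares. The bound is linear in the distances to x, which is
  why a first moment suffices to define barycenters.\<close>

lemma abs_dist_power2_diff_le:
  fixes x y z :: "'a::metric_space"
  shows "\<bar>(dist z x)\<^sup>2 - (dist y x)\<^sup>2\<bar> \<le> dist z y * (dist z x + dist y x)"
proof -
  have "(dist z x)\<^sup>2 - (dist y x)\<^sup>2 = (dist z x - dist y x) * (dist z x + dist y x)"
    by (simp add: power2_eq_square algebra_simps)
  then have "\<bar>(dist z x)\<^sup>2 - (dist y x)\<^sup>2\<bar> = \<bar>dist z x - dist y x\<bar> * (dist z x + dist y x)"
    by (simp add: abs_mult)
  also have "\<dots> \<le> dist z y * (dist z x + dist y x)"
    using abs_dist_diff_le[of z x y] by (intro mult_right_mono) (auto simp: dist_commute)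
  finally show ?thesis .
qed

text \<open>The reference point \<open>q\<close> witnesses the finite first moment and also
  normalises the functional \<open>bary_fun\<close>, which is then finite without a second
  moment.\<close>

locale integrable_rv = prob_space M for M :: "'w measure" +
  fixes X :: "'w \<Rightarrow> 'h::separable_hadamard_space" and q :: 'h
  assumes X[measurable]: "X \<in> borel_measurable M"
    and int: "integrable M (\<lambda>\<omega>. dist q (X \<omega>))"
begin

lemma integrable_dist: "integrable M (\<lambda>\<omega>. dist z (X \<omega>))"
proof (rule Bochner_Integration.integrable_bound)
  show "integrable M (\<lambda>\<omega>. dist z q + dist q (X \<omega>))"
    using int by simp
qed (use X dist_triangle[of z _ q] in auto)

lemma integrable_dist_power2_diff: "integrable M (\<lambda>\<omega>. (dist z (X \<omega>))\<^sup>2 - (dist y (X \<omega>))\<^sup>2)"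
proof (rule Bochner_Integration.integrable_bound)
  show "integrable M (\<lambda>\<omega>. dist z y * (dist z (X \<omega>) + dist y (X \<omega>)))"
    using integrable_dist by simp
qed (use X abs_dist_power2_diff_le[of z _ y] in auto)

abbreviation "bary_fun z \<equiv> \<integral>\<omega>. (dist z (X \<omega>))\<^sup>2 - (dist q (X \<omega>))\<^sup>2 \<partial>M"

lemma bary_fun_diff:
  "(\<integral>\<omega>. (dist z (X \<omega>))\<^sup>2 - (dist y (X \<omega>))\<^sup>2 \<partial>M) = bary_fun z - bary_fun y"
  by (subst Bochner_Integration.integral_diff[symmetric])
     (auto intro: integrable_dist_power2_diff)

text \<open>Integrating the curvature inequality makes the functional strongly convex. Existence,
  uniqueness and the variance inequality for minimisers all come from this.\<close>

lemma bary_fun_geodesic_point_le: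
  assumes t: "0 \<le> t" "t \<le> 1"
  shows "bary_fun (geodesic_point t z w) \<le>
    (1 - t) * bary_fun z + t * bary_fun w - t * (1 - t) * (dist z w)\<^sup>2"
proof -
  have "bary_fun (geodesic_point t z w) \<le> (\<integral>\<omega>. (1 - t) * ((dist z (X \<omega>))\<^sup>2 - (dist q (X \<omega>))\<^sup>2)
      + t * ((dist w (X \<omega>))\<^sup>2 - (dist q (X \<omega>))\<^sup>2) - t * (1 - t) * (dist z w)\<^sup>2 \<partial>M)"
  proof (rule integral_mono)
    show "(dist (geodesic_point t z w) (X \<omega>))\<^sup>2 - (dist q (X \<omega>))\<^sup>2
      \<le> (1 - t) * ((dist z (X \<omega>))\<^sup>2 - (dist q (X \<omega>))\<^sup>2)
      + t * ((dist w (X \<omega>))\<^sup>2 - (dist q (X \<omega>))\<^sup>2) - t * (1 - t) * (dist z w)\<^sup>2" for \<omega>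
      using geodesic_point_dist_le[OF t, of z w "X \<omega>"] by (simp add: algebra_simps)
  qed (auto intro!: integrable_dist_power2_diff Bochner_Integration.integrable_diff
        Bochner_Integration.integrable_add integrable_mult_right)
  also have "\<dots> = (1 - t) * bary_fun z + t * bary_fun w - t * (1 - t) * (dist z w)\<^sup>2"
    using integrable_dist_power2_diff by (simp add: prob_space)
  finally show ?thesis .
qed

text \<open>Square the reverse triangle inequality and integrate. This quadratic growth bounds the
  functional below and confines its minimiser to a ball around \<open>q\<close>.\<close>

lemma bary_fun_ge:
  "(dist q z)\<^sup>2 - 2 * dist q z * expectation (\<lambda>\<omega>. dist q (X \<omega>)) \<le> bary_fun z"
proof -
  have "(\<integral>\<omega>. (dist q z)\<^sup>2 - 2 * dist q z * dist q (X \<omega>) \<partial>M) \<le> bary_fun z"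
  proof (rule integral_mono)
    fix \<omega>
    have "(dist q z - dist q (X \<omega>))\<^sup>2 \<le> (dist z (X \<omega>))\<^sup>2"
      using dist_triangle[of q z "X \<omega>"] dist_triangle[of q "X \<omega>" z]
      by (intro abs_le_square_iff[THEN iffD1]) (auto simp: dist_commute)
    then show "(dist q z)\<^sup>2 - 2 * dist q z * dist q (X \<omega>) \<le> (dist z (X \<omega>))\<^sup>2 - (dist q (X \<omega>))\<^sup>2"
      by (simp add: power2_diff)
  qed (use int integrable_dist_power2_diff in auto)
  also have "(\<integral>\<omega>. (dist q z)\<^sup>2 - 2 * dist q z * dist q (X \<omega>) \<partial>M)
      = (dist q z)\<^sup>2 - 2 * dist q z * expectation (\<lambda>\<omega>. dist q (X \<omega>))"
    using int by (simp add: prob_space)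
  finally show ?thesis .
qed

text \<open>The difference of two values is at most the distance of the arguments times a factor
  that stays bounded near z.\<close>

lemma continuous_bary_fun: "continuous_on UNIV bary_fun"
proof (rule continuous_at_imp_continuous_on, intro ballI)
  fix z
  let ?E = "expectation (\<lambda>\<omega>. dist q (X \<omega>))"
  have le: "\<bar>bary_fun y - bary_fun z\<bar> \<le> dist y z * (dist y q + dist z q + 2 * ?E)" for y
  proof -
    have "\<bar>bary_fun y - bary_fun z\<bar> = \<bar>\<integral>\<omega>. (dist y (X \<omega>))\<^sup>2 - (dist z (X \<omega>))\<^sup>2 \<partial>M\<bar>"
      by (simp only: bary_fun_diff[of y z])
    also have "\<dots> \<le> (\<integral>\<omega>. \<bar>(dist y (X \<omega>))\<^sup>2 - (dist z (X \<omega>))\<^sup>2\<bar> \<partial>M)"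
      by simp
    also have "\<dots> \<le> (\<integral>\<omega>. dist y z * (dist y q + dist z q + 2 * dist q (X \<omega>)) \<partial>M)"
    proof (rule integral_mono)
      fix \<omega>
      have "dist y (X \<omega>) + dist z (X \<omega>) \<le> dist y q + dist z q + 2 * dist q (X \<omega>)"
        using dist_triangle[of y "X \<omega>" q] dist_triangle[of z "X \<omega>" q] by simp
      then show "\<bar>(dist y (X \<omega>))\<^sup>2 - (dist z (X \<omega>))\<^sup>2\<bar> \<le> dist y z * (dist y q + dist z q + 2 * dist q (X \<omega>))"
        using abs_dist_power2_diff_le[of y "X \<omega>" z]
        by (meson mult_left_mono order_trans zero_le_dist)
    qed (use int integrable_dist_power2_diff in \<open>auto intro!: integrable_mult_right\<close>)
    also have "\<dots> = dist y z * (dist y q + dist z q + 2 * ?E)"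
      using int by (simp add: prob_space)
    finally show ?thesis .
  qed
  have "((\<lambda>y. dist y z * (dist y q + dist z q + 2 * ?E)) \<longlongrightarrow>
      dist z z * (dist z q + dist z q + 2 * ?E)) (at z)"
    by (intro tendsto_intros)
  then have "((\<lambda>y. dist y z * (dist y q + dist z q + 2 * ?E)) \<longlongrightarrow> 0) (at z)"
    by (simp only: dist_self mult_zero_left)
  then have "((\<lambda>y. bary_fun y - bary_fun z) \<longlongrightarrow> 0) (at z)"
    by (rule Lim_null_comparison[OF always_eventually, rotated]) (simp only: real_norm_def le simp_thms)
  then show "isCont bary_fun z"
    unfolding isCont_def by (rule LIM_zero_cancel)
qed

text \<open>Strong convexity replaces compactness: every minimising sequence with controlled error
  is Cauchy, so completeness and continuity give a minimiser.\<close>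

lemma ex_bary_fun_min: "\<exists>b. \<forall>z. bary_fun b \<le> bary_fun z"
proof -
  let ?m = "expectation (\<lambda>\<omega>. dist q (X \<omega>))"
  \<comment> \<open>Complete the square in the lower bound r^2 - 2rm with r = d(q,z).\<close>
  have "- ?m\<^sup>2 \<le> bary_fun z" for z
    using bary_fun_ge[of z] zero_le_power2[of "dist q z - ?m"] by (simp add: power2_diff)
  then have bdd: "bdd_below (range bary_fun)"
    by (rule bdd_belowI2)
  define I where "I = (INF z. bary_fun z)"
  have I: "I \<le> bary_fun z" for z
    unfolding I_def by (rule cINF_lower[OF bdd]) simp
  have "\<exists>z. bary_fun z < I + 1 / real (Suc n)" for n
    using cInf_lessD[of "range bary_fun" "I + 1 / real (Suc n)"] by (auto simp: I_def)
  then obtain Z where Z: "\<And>n. bary_fun (Z n) < I + 1 / real (Suc n)"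
    by metis
  have ZZ: "(dist (Z m) (Z n))\<^sup>2 \<le> 2 / real (Suc m) + 2 / real (Suc n)" for m n
  proof -
    \<comment> \<open>The midpoint has value at least the infimum, so a quarter of the squared
      distance is bounded by the mean of the two excesses over the infimum.\<close>
    have "I \<le> (1 - 1/2) * bary_fun (Z m) + 1/2 * bary_fun (Z n) - 1/2 * (1 - 1/2) * (dist (Z m) (Z n))\<^sup>2"
      using I bary_fun_geodesic_point_le[of "1/2" "Z m" "Z n"] order_trans by fastforce
    then show ?thesis
      using Z[of m] Z[of n] by simp
  qed
  have "Cauchy Z"
  proof (rule CauchyI')
    fix e :: real assume e: "e > 0"
    obtain N where N: "1 / real (Suc N) < e\<^sup>2 / 4"
      using nat_approx_posE[of "e\<^sup>2 / 4"] e by auto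
    have "dist (Z m) (Z n) < e" if "m \<ge> N" "n > m" for m n
    proof (rule power2_less_imp_less)
      have "1 / real (Suc k) \<le> 1 / real (Suc N)" if "k \<ge> N" for k
        using that by (intro frac_le) auto
      from this[of m] this[of n] that show "(dist (Z m) (Z n))\<^sup>2 < e\<^sup>2"
        using ZZ[of m n] N by simp
    qed (use e in auto)
    then show "\<exists>M. \<forall>m\<ge>M. \<forall>n>m. dist (Z m) (Z n) < e"
      by blast
  qed
  then obtain b where b: "Z \<longlonglongrightarrow> b"
    using Cauchy_convergent convergent_def by blast
  have "(\<lambda>n. bary_fun (Z n)) \<longlonglongrightarrow> bary_fun b"
    using continuous_bary_fun b by (rule continuous_on_tendsto_compose) auto
  moreover have "(\<lambda>n. I + 1 / real (Suc n)) \<longlonglongrightarrow> I + 0"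
    by (intro tendsto_add tendsto_const LIMSEQ_Suc[OF lim_1_over_n])
  ultimately have "bary_fun b \<le> I + 0"
    by (rule LIMSEQ_le) (use Z less_imp_le in blast)
  then have "bary_fun b \<le> I"
    by simp
  with I show ?thesis
    using order_trans by blast
qed

text \<open>Compare \<open>b\<close> with the point at parameter t towards \<open>z\<close>:
  minimality and strong convexity give an inequality with a common factor t. Divide by t and let t
  tend to 0.\<close>

lemma bary_fun_min_variance:
  assumes b: "\<And>z. bary_fun b \<le> bary_fun z"
  shows "(dist z b)\<^sup>2 \<le> bary_fun z - bary_fun b"
proof (rule tendsto_upperbound)
  show "((\<lambda>t. (1 - t) * (dist z b)\<^sup>2) \<longlongrightarrow> (dist z b)\<^sup>2) (at_right 0)"
    by (auto intro!: tendsto_eq_intros)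
  have "eventually (\<lambda>t::real. t \<in> {0<..<1}) (at_right 0)"
    by (rule eventually_at_right_real) simp
  then show "\<forall>\<^sub>F t in at_right 0. (1 - t) * (dist z b)\<^sup>2 \<le> bary_fun z - bary_fun b"
  proof eventually_elim
    case (elim t)
    then have "t * ((1 - t) * (dist z b)\<^sup>2) \<le> t * (bary_fun z - bary_fun b)"
      using bary_fun_geodesic_point_le[of t b z] b[of "geodesic_point t b z"]
      by (simp add: algebra_simps dist_commute)
    then show ?case
      using elim by simp
  qed
qed simp

lemma barycenter_minimises: "bary_fun (barycenter M X) \<le> bary_fun z"
proof -
  obtain b where b: "\<And>z. bary_fun b \<le> bary_fun z"
    using ex_bary_fun_min by blast
  \<comment> \<open>Changing y shifts the functional by a constant, so the minimisers are the same
    for all y and the quantifier in the definition is harmless. The variance inequality then makes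
    the minimiser unique.\<close>
  have arg_min: "is_arg_min (\<lambda>z. \<integral>\<omega>. (dist z (X \<omega>))\<^sup>2 - (dist y (X \<omega>))\<^sup>2 \<partial>M) (\<lambda>_. True) c \<longleftrightarrow>
      (\<forall>z. bary_fun c \<le> bary_fun z)" for y c
    using bary_fun_diff[of _ y] by (simp add: is_arg_min_def not_less)
  have "barycenter M X = b"
    unfolding barycenter_def arg_min
  proof (rule the_equality)
    show "\<forall>y z. bary_fun b \<le> bary_fun z"
      using b by blast
    fix c assume "\<forall>y z. bary_fun c \<le> bary_fun z"
    then have "bary_fun c \<le> bary_fun b"
      by blast
    then have "(dist c b)\<^sup>2 \<le> 0"
      using bary_fun_min_variance[OF b, of c] by linarith
    then show "c = b" by simp
  qed
  with b show ?thesis by simp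
qed

lemma barycenter_variance:
  "(dist z (barycenter M X))\<^sup>2 \<le>
     (\<integral>\<omega>. (dist z (X \<omega>))\<^sup>2 - (dist (barycenter M X) (X \<omega>))\<^sup>2 \<partial>M)"
  using bary_fun_min_variance[OF barycenter_minimises, of z] bary_fun_diff[of z "barycenter M X"]
  by (rule ord_le_eq_trans[OF _ sym])

text \<open>The functional vanishes at \<open>q\<close>, hence is at most 0 at the barycenter. With
  r the distance and m the first moment, the growth bound reads r^2 - 2rm <= 0.\<close>

lemma dist_barycenter_le:
  "dist q (barycenter M X) \<le> 2 * expectation (\<lambda>\<omega>. dist q (X \<omega>))"
proof (rule ccontr)
  let ?r = "dist q (barycenter M X)" and ?m = "expectation (\<lambda>\<omega>. dist q (X \<omega>))"
  assume "\<not> ?r \<le> 2 * ?m"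
  moreover have "0 \<le> ?m"
    by simp
  ultimately have "0 < ?r" "0 < ?r - 2 * ?m"
    by linarith+
  then have "0 < ?r * (?r - 2 * ?m)"
    by (rule mult_pos_pos)
  with bary_fun_ge[of "barycenter M X"] barycenter_minimises[of q] show False
    by (simp add: power2_eq_square algebra_simps)
qed

end

section \<open>Independent and identically distributed sequences\<close>

text \<open>By injectivity, events indexed by a finite subset of \<open>I\<close> can be relabelled
  by its image under \<open>f\<close>, where independence is given. It serves to number a shifted
  block of variables from 0.\<close>

lemma (in prob_space) indep_vars_reindex:
  assumes f: "inj_on f I" and ind: "indep_vars M' X (f ` I)"
  shows "indep_vars (\<lambda>i. M' (f i)) (\<lambda>i. X (f i)) I"
  unfolding indep_vars_def2 indep_sets_def
proof (intro conjI ballI allI impI)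
  let ?F = "\<lambda>i. {X i -` A \<inter> space M |A. A \<in> sets (M' i)}"
  have ind': "random_variable (M' (f i)) (X (f i))" if "i \<in> I" for i
    using ind that unfolding indep_vars_def2 by blast
  then show "random_variable (M' (f i)) (X (f i))" if "i \<in> I" for i
    using that .
  show "?F (f i) \<subseteq> events" if "i \<in> I" for i
    using ind'[OF that] by (auto intro: measurable_sets)
  fix J A assume J: "J \<subseteq> I" "J \<noteq> {}" "finite J" and A: "A \<in> Pi J (\<lambda>i. ?F (f i))"
  have inj: "inj_on f J"
    using f J(1) inj_on_subset by blast
  let ?B = "\<lambda>j. A (the_inv_into J f j)"
  have "\<forall>A\<in>Pi (f ` J) ?F. prob (\<Inter>j\<in>f ` J. A j) = (\<Prod>j\<in>f ` J. prob (A j))"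
    using ind J unfolding indep_vars_def2 indep_sets_def by (metis (no_types, lifting) finite_imageI image_is_empty image_mono)
  moreover have "?B \<in> Pi (f ` J) ?F"
    using A inj by (auto simp: Pi_iff the_inv_into_f_f)
  ultimately have "prob (\<Inter>j\<in>f ` J. ?B j) = (\<Prod>j\<in>f ` J. prob (?B j))"
    by blast
  then show "prob (\<Inter>j\<in>J. A j) = (\<Prod>j\<in>J. prob (A j))"
    using inj by (simp add: prod.reindex the_inv_into_f_f)
qed

lemma iid_imp_distr_eq: "iid P X \<Longrightarrow> i \<ge> 1 \<Longrightarrow> distr P borel (X i) = distr P borel (X 1)"
  unfolding iid_def by blast

lemma iid_imp_indep_vars: "iid P X \<Longrightarrow> prob_space.indep_vars P (\<lambda>_. borel) X {1..}"
  unfolding iid_def by blast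

lemma iid_compose:
  fixes X :: "nat \<Rightarrow> 'w \<Rightarrow> 'a::topological_space" and f :: "'a \<Rightarrow> 'b::topological_space"
  assumes P: "prob_space P" and X: "\<And>i. i \<ge> 1 \<Longrightarrow> X i \<in> borel_measurable P"
    and iid: "iid P X" and f: "f \<in> borel_measurable borel"
  shows "iid P (\<lambda>i \<omega>. f (X i \<omega>))"
proof -
  interpret prob_space P by fact
  have "distr P borel (\<lambda>\<omega>. f (X i \<omega>)) = distr (distr P borel (X i)) borel f" if "i \<ge> 1" for i
    using distr_distr[OF f X[OF that]] by (simp add: comp_def)
  then have "distr P borel (\<lambda>\<omega>. f (X i \<omega>)) = distr P borel (\<lambda>\<omega>. f (X 1 \<omega>))" if "i \<ge> 1" for i
    by (simp only: that iid_imp_distr_eq[OF iid that] order_refl)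
  moreover have "indep_vars (\<lambda>_. borel) (\<lambda>i \<omega>. f (X i \<omega>)) {1..}"
    by (rule indep_vars_compose2[OF iid_imp_indep_vars[OF iid] f])
  ultimately show ?thesis
    unfolding iid_def by blast
qed

lemma iid_expectation_eq:
  fixes f :: "'a::topological_space \<Rightarrow> real"
  assumes X: "\<And>i. i \<ge> 1 \<Longrightarrow> X i \<in> borel_measurable P"
    and iid: "iid P X" and f: "f \<in> borel_measurable borel" and i: "i \<ge> 1"
  shows "(\<integral>\<omega>. f (X i \<omega>) \<partial>P) = (\<integral>\<omega>. f (X 1 \<omega>) \<partial>P)"
proof -
  have "(\<integral>\<omega>. f (X i \<omega>) \<partial>P) = integral\<^sup>L (distr P borel (X i)) f"
    by (rule integral_distr[symmetric, OF X[OF i] f])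
  also have "distr P borel (X i) = distr P borel (X 1)"
    by (rule iid_imp_distr_eq[OF iid i])
  also have "integral\<^sup>L \<dots> f = (\<integral>\<omega>. f (X 1 \<omega>) \<partial>P)"
    by (rule integral_distr[OF X f]) simp
  finally show ?thesis .
qed

lemma iid_integrable:
  fixes f :: "'a::topological_space \<Rightarrow> real"
  assumes X: "\<And>i. i \<ge> 1 \<Longrightarrow> X i \<in> borel_measurable P"
    and iid: "iid P X" and f: "f \<in> borel_measurable borel" and i: "i \<ge> 1"
    and int: "integrable P (\<lambda>\<omega>. f (X 1 \<omega>))"
  shows "integrable P (\<lambda>\<omega>. f (X i \<omega>))"
proof -
  have "integrable (distr P borel (X 1)) f"
    using integrable_distr_eq[OF X f, of 1] int by simp
  also have "distr P borel (X 1) = distr P borel (X i)"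
    by (rule iid_imp_distr_eq[OF iid i, symmetric])
  finally show ?thesis
    using integrable_distr_eq[OF X[OF i] f] by simp
qed

text \<open>Independence makes the joint law a product, and identical distribution makes the factors
  equal. The right-hand side is free of \<open>k\<close>: this is the stationarity behind the
  maximal inequality.\<close>

lemma iid_distr_shift:
  assumes P: "prob_space P" and X: "\<And>i. i \<ge> 1 \<Longrightarrow> X i \<in> borel_measurable P"
    and iid: "iid P X" and L: "L > 0"
  shows "distr P (\<Pi>\<^sub>M i\<in>{..<L}. borel) (\<lambda>\<omega>. \<lambda>i\<in>{..<L}. X (Suc (i + k)) \<omega>) =
    (\<Pi>\<^sub>M i\<in>{..<L}. distr P borel (X 1))"
proof -
  interpret prob_space P by fact
  have "indep_vars (\<lambda>_. borel) X ((\<lambda>i. Suc (i + k)) ` {..<L})"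
    by (rule indep_vars_subset[OF iid_imp_indep_vars[OF iid]]) auto
  then have "indep_vars (\<lambda>_. borel) (\<lambda>i. X (Suc (i + k))) {..<L}"
    by (rule indep_vars_reindex[rotated]) (auto simp: inj_on_def)
  then have "distr P (\<Pi>\<^sub>M i\<in>{..<L}. borel) (\<lambda>\<omega>. \<lambda>i\<in>{..<L}. X (Suc (i + k)) \<omega>) =
    (\<Pi>\<^sub>M i\<in>{..<L}. distr P borel (X (Suc (i + k))))"
    using L X by (subst (asm) indep_vars_iff_distr_eq_PiM') auto
  also have "\<dots> = (\<Pi>\<^sub>M i\<in>{..<L}. distr P borel (X 1))"
    by (intro PiM_cong refl iid_imp_distr_eq[OF iid]) simp
  finally show ?thesis .
qed

section \<open>A maximal inequality\<close>

text \<open>This is the maximum over n <= L of the sums y_0 + ... + y_(n-1), the empty sum included.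
  The recursion on the first term exhibits the shifted sequence.\<close>

primrec max_partial_sum :: "nat \<Rightarrow> (nat \<Rightarrow> real) \<Rightarrow> real" where
  "max_partial_sum 0 y = 0"
| "max_partial_sum (Suc L) y = max 0 (y 0 + max_partial_sum L (\<lambda>i. y (Suc i)))"

lemma max_partial_sum_nonneg: "0 \<le> max_partial_sum L y"
  by (cases L) auto

lemma sum_le_max_partial_sum: "n \<le> L \<Longrightarrow> (\<Sum>i<n. y i) \<le> max_partial_sum L y"
proof (induction L arbitrary: n y)
  case (Suc L)
  show ?case
  proof (cases n)
    case (Suc n')
    then show ?thesis
      using Suc.IH[of n' "\<lambda>i. y (Suc i)"] Suc.prems by (simp add: sum.lessThan_Suc_shift del: sum.lessThan_Suc)
  qed (simp add: max_partial_sum_nonneg)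
qed simp

lemma max_partial_sum_mono: "max_partial_sum L y \<le> max_partial_sum (Suc L) y"
proof (induction L arbitrary: y)
  case (Suc L)
  from Suc[of "\<lambda>i. y (Suc i)"] show ?case by simp
qed simp

lemma max_partial_sum_le: "max_partial_sum L y \<le> (\<Sum>i<L. \<bar>y i\<bar>)"
proof (induction L arbitrary: y)
  case (Suc L)
  have "max_partial_sum (Suc L) y \<le> \<bar>y 0\<bar> + (\<Sum>i<L. \<bar>y (Suc i)\<bar>)"
    using Suc[of "\<lambda>i. y (Suc i)"] sum_nonneg[of "{..<L}" "\<lambda>i. \<bar>y (Suc i)\<bar>"] by simp
  then show ?case
    by (simp only: sum.lessThan_Suc_shift)
qed simp

lemma max_partial_sum_cong:
  "(\<And>i. i < L \<Longrightarrow> y i = z i) \<Longrightarrow> max_partial_sum L y = max_partial_sum L z"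
proof (induction L arbitrary: y z)
  case (Suc L)
  have "max_partial_sum L (\<lambda>i. y (Suc i)) = max_partial_sum L (\<lambda>i. z (Suc i))"
    by (rule Suc.IH) (use Suc.prems in simp)
  with Suc.prems[of 0] show ?case by simp
qed simp

lemma borel_measurable_max_partial_sum:
  "(\<And>i. i < L \<Longrightarrow> Y i \<in> borel_measurable M) \<Longrightarrow>
    (\<lambda>\<omega>. max_partial_sum L (\<lambda>i. Y i \<omega>)) \<in> borel_measurable M"
proof (induction L arbitrary: Y)
  case (Suc L)
  then have [measurable]: "Y 0 \<in> borel_measurable M"
    "(\<lambda>\<omega>. max_partial_sum L (\<lambda>i. Y (Suc i) \<omega>)) \<in> borel_measurable M"
    by simp_all
  show ?case by simp
qed simp

text \<open>Garsia's pointwise inequality. If the maximum is positive, it equals y_0 plus the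
  maximum of length L - 1 of the shifted sequence, which increases with the length. Otherwise it is
  0, and the subtracted term is nonnegative.\<close>

lemma max_partial_sum_diff_le:
  "max_partial_sum L y - max_partial_sum L (\<lambda>i. y (Suc i)) \<le> (if 0 < max_partial_sum L y then y 0 else 0)"
proof (cases L)
  case (Suc L')
  then show ?thesis
    using max_partial_sum_mono[of L' "\<lambda>i. y (Suc i)"] max_partial_sum_nonneg[of L "\<lambda>i. y (Suc i)"]
    by simp
qed simp

text \<open>Garsia's argument for the maximal ergodic theorem: \<open>max_partial_sum L\<close> has the same
  expectation on the sequence and on its shift.\<close>

lemma iid_maximal_inequality:
  fixes Y :: "nat \<Rightarrow> 'w \<Rightarrow> real"
  assumes P: "prob_space P" and Y: "\<And>i. i \<ge> 1 \<Longrightarrow> Y i \<in> borel_measurable P"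
    and iid: "iid P Y" and nonneg: "\<And>i \<omega>. 0 \<le> Y i \<omega>" and int: "integrable P (Y 1)"
    and c: "c > 0"
  shows "c * measure P {\<omega>\<in>space P. \<exists>n\<ge>1. c * real n < (\<Sum>i<n. Y (Suc i) \<omega>)} \<le> (\<integral>\<omega>. Y 1 \<omega> \<partial>P)"
proof -
  interpret prob_space P by fact
  have [measurable]: "Y (Suc i) \<in> borel_measurable P" for i
    by (rule Y) simp
  \<comment> \<open>Centring at c turns "some average exceeds c" into "some partial sum is
    positive"; \<open>A L\<close> is this event for the first L averages.\<close>
  define S where "S k L \<omega> = max_partial_sum L (\<lambda>i. Y (Suc (i + k)) \<omega> - c)" for k L \<omega>
  define A where "A L = {\<omega>\<in>space P. 0 < S 0 L \<omega>}" for L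
  have S_meas[measurable]: "S k L \<in> borel_measurable P" for k L
    unfolding S_def by (rule borel_measurable_max_partial_sum) simp
  have A[measurable]: "A L \<in> sets P" for L
    unfolding A_def by measurable
  have int': "integrable P (Y i)" if "i \<ge> 1" for i
    using iid_integrable[OF Y iid, of "\<lambda>x. x" i] that int by simp
  have S_int: "integrable P (S k L)" for k L
  proof (rule Bochner_Integration.integrable_bound)
    show "integrable P (\<lambda>\<omega>. \<Sum>i<L. \<bar>Y (Suc (i + k)) \<omega> - c\<bar>)"
      using int' by auto
    show "AE \<omega> in P. norm (S k L \<omega>) \<le> norm (\<Sum>i<L. \<bar>Y (Suc (i + k)) \<omega> - c\<bar>)"
      using max_partial_sum_nonneg max_partial_sum_le by (auto simp: S_def sum_nonneg abs_of_nonneg)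
  qed simp
  \<comment> \<open>Both variables are the same function \<open>g\<close> of blocks of length L with
    equal joint laws.\<close>
  have S_shift: "expectation (S k L) = expectation (S 0 L)" for k L
  proof (cases "L = 0")
    case False
    define g where "g z = max_partial_sum L (\<lambda>i. z i - c)" for z
    have [measurable]: "g \<in> borel_measurable (\<Pi>\<^sub>M i\<in>{..<L}. borel)"
      unfolding g_def by (rule borel_measurable_max_partial_sum) simp
    have "expectation (S k L) = integral\<^sup>L (\<Pi>\<^sub>M i\<in>{..<L}. distr P borel (Y 1)) g" for k
    proof -
      have "S k L = (\<lambda>\<omega>. g (\<lambda>i\<in>{..<L}. Y (Suc (i + k)) \<omega>))"
        unfolding S_def g_def by (intro ext max_partial_sum_cong) simp
      then have "expectation (S k L) =
          integral\<^sup>L (distr P (\<Pi>\<^sub>M i\<in>{..<L}. borel) (\<lambda>\<omega>. \<lambda>i\<in>{..<L}. Y (Suc (i + k)) \<omega>)) g"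
        by (subst integral_distr) auto
      then show ?thesis
        using iid_distr_shift[OF P Y iid] False by simp
    qed
    then show ?thesis by metis
  qed (simp add: S_def[abs_def])
  \<comment> \<open>Integrate Garsia's inequality: the left side has mean zero by stationarity, and
    nonnegativity of \<open>Y 1\<close> lets the indicator be dropped from \<open>Y 1\<close> but
    kept on c.\<close>
  have bound: "c * prob (A L) \<le> expectation (Y 1)" for L
  proof -
    have "S 0 L \<omega> - S 1 L \<omega> \<le> Y 1 \<omega> - c * indicator (A L) \<omega>" if "\<omega> \<in> space P" for \<omega>
      using max_partial_sum_diff_le[of L "\<lambda>i. Y (Suc i) \<omega> - c"] nonneg[of 1 \<omega>] that
      by (auto simp: S_def A_def indicator_def split: if_splits)
    moreover have ind: "integrable P (\<lambda>\<omega>. c * indicator (A L) \<omega>)"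
      by (intro integrable_mult_right integrable_real_indicator A) (simp add: less_top[symmetric])
    ultimately have "(\<integral>\<omega>. S 0 L \<omega> - S 1 L \<omega> \<partial>P) \<le> (\<integral>\<omega>. Y 1 \<omega> - c * indicator (A L) \<omega> \<partial>P)"
      using int S_int by (intro integral_mono Bochner_Integration.integrable_diff) auto
    moreover have "(\<integral>\<omega>. S 0 L \<omega> - S 1 L \<omega> \<partial>P) = 0"
      using S_int S_shift[of 1 L] by simp
    moreover have "(\<integral>\<omega>. Y 1 \<omega> - c * indicator (A L) \<omega> \<partial>P) = expectation (Y 1) - c * prob (A L)"
      by (subst Bochner_Integration.integral_diff[OF int ind]) simp
    ultimately show ?thesis by simp
  qed
  \<comment> \<open>Continuity from below removes the restriction to n <= L.\<close>
  have "incseq A"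
    unfolding A_def S_def using max_partial_sum_mono less_le_trans by (intro incseq_SucI) blast
  then have "(\<lambda>L. c * prob (A L)) \<longlonglongrightarrow> c * prob (\<Union>L. A L)"
    using A by (intro tendsto_mult_left finite_Lim_measure_incseq) auto
  then have "c * prob (\<Union>L. A L) \<le> expectation (Y 1)"
    by (rule LIMSEQ_le_const2) (use bound in auto)
  moreover have "{\<omega>\<in>space P. \<exists>n\<ge>1. c * real n < (\<Sum>i<n. Y (Suc i) \<omega>)} \<subseteq> (\<Union>L. A L)"
  proof safe
    fix \<omega> n assume "\<omega> \<in> space P" "c * real n < (\<Sum>i<n. Y (Suc i) \<omega>)"
    moreover have "(\<Sum>i<n. Y (Suc i) \<omega> - c) \<le> S 0 n \<omega>"
      using sum_le_max_partial_sum[of n n "\<lambda>i. Y (Suc i) \<omega> - c"] by (simp add: S_def)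
    ultimately show "\<omega> \<in> (\<Union>L. A L)"
      by (auto simp: A_def sum_subtractf mult.commute intro!: exI[of _ n])
  qed
  then have "prob {\<omega>\<in>space P. \<exists>n\<ge>1. c * real n < (\<Sum>i<n. Y (Suc i) \<omega>)} \<le> prob (\<Union>L. A L)"
    using A by (intro finite_measure_mono sets.countable_UN) auto
  then have "c * prob {\<omega>\<in>space P. \<exists>n\<ge>1. c * real n < (\<Sum>i<n. Y (Suc i) \<omega>)} \<le> c * prob (\<Union>L. A L)"
    using c by simp
  ultimately show ?thesis
    by linarith
qed

section \<open>Bounded variables\<close>

text \<open>By independence and Fubini, the value of \<open>S\<close> may be frozen while averaging
  over \<open>Y\<close>. The assumed variance inequality then applies for each frozen value; the
  bound \<open>K\<close> supplies integrability.\<close>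

lemma (in prob_space) expectation_dist_power2_indep_ge:
  fixes S Y :: "'a \<Rightarrow> 'h::{second_countable_topology, metric_space}"
  assumes indep: "indep_var borel S borel Y"
    and S: "\<And>\<omega>. \<omega> \<in> space M \<Longrightarrow> dist q (S \<omega>) \<le> K"
    and Y: "\<And>\<omega>. \<omega> \<in> space M \<Longrightarrow> dist q (Y \<omega>) \<le> K"
    and V: "\<And>z. (dist z b)\<^sup>2 + V \<le> expectation (\<lambda>\<omega>. (dist z (Y \<omega>))\<^sup>2)"
  shows "expectation (\<lambda>\<omega>. (dist (S \<omega>) b)\<^sup>2) + V \<le> expectation (\<lambda>\<omega>. (dist (S \<omega>) (Y \<omega>))\<^sup>2)"
proof -
  have [measurable]: "S \<in> borel_measurable M" "Y \<in> borel_measurable M"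
    and eq: "distr M borel S \<Otimes>\<^sub>M distr M borel Y = distr M (borel \<Otimes>\<^sub>M borel) (\<lambda>\<omega>. (S \<omega>, Y \<omega>))"
    using indep unfolding indep_var_distribution_eq by blast+
  interpret S: prob_space "distr M borel S"
    by (rule prob_space_distr) simp
  interpret Y: prob_space "distr M borel Y"
    by (rule prob_space_distr) simp
  interpret SY: pair_prob_space "distr M borel S" "distr M borel Y" ..
  let ?f = "\<lambda>(s::'h, y). (dist s y)\<^sup>2"
  have f[measurable]: "?f \<in> borel_measurable (borel \<Otimes>\<^sub>M borel)"
    by measurable
  have bounded: "integrable M g" if "g \<in> borel_measurable M" "\<And>\<omega>. \<omega> \<in> space M \<Longrightarrow> \<bar>g \<omega>\<bar> \<le> C"
    for g :: "'a \<Rightarrow> real" and C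
    using that by (intro integrable_const_bound[where B=C]) auto
  have SY_le: "(dist (S \<omega>) (Y \<omega>'))\<^sup>2 \<le> (2 * K)\<^sup>2" if "\<omega> \<in> space M" "\<omega>' \<in> space M" for \<omega> \<omega>'
    using S[OF that(1)] Y[OF that(2)] dist_triangle3[of "S \<omega>" "Y \<omega>'" q] by (intro power_mono) auto
  have "integrable M (\<lambda>\<omega>. ?f (S \<omega>, Y \<omega>))"
    by (rule bounded[of _ "(2 * K)\<^sup>2"]) (use SY_le in auto)
  then have int: "integrable (distr M borel S \<Otimes>\<^sub>M distr M borel Y) ?f"
    unfolding eq by (subst integrable_distr_eq) auto
  have "(dist (S \<omega>) b)\<^sup>2 \<le> (K + dist q b)\<^sup>2" if "\<omega> \<in> space M" for \<omega>
    using S[OF that] dist_triangle3[of "S \<omega>" b q] by (intro power_mono) auto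
  then have int_S: "integrable M (\<lambda>\<omega>. (dist (S \<omega>) b)\<^sup>2)"
    by (intro bounded[of _ "(K + dist q b)\<^sup>2"]) auto
  have [measurable]: "(\<lambda>s. expectation (\<lambda>\<omega>. (dist s (Y \<omega>))\<^sup>2)) \<in> borel_measurable borel"
    by measurable
  have "expectation (\<lambda>\<omega>. (dist (S \<omega>) (Y \<omega>))\<^sup>2) = integral\<^sup>L (distr M borel S \<Otimes>\<^sub>M distr M borel Y) ?f"
    unfolding eq by (subst integral_distr) auto
  also have "\<dots> = (\<integral>s. (\<integral>y. ?f (s, y) \<partial>distr M borel Y) \<partial>distr M borel S)"
    by (rule SY.integral_fst'[OF int, symmetric])
  also have "\<dots> = (\<integral>s. expectation (\<lambda>\<omega>. (dist s (Y \<omega>))\<^sup>2) \<partial>distr M borel S)"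
    by (subst integral_distr) auto
  also have "\<dots> = expectation (\<lambda>\<omega>. expectation (\<lambda>\<omega>'. (dist (S \<omega>) (Y \<omega>'))\<^sup>2))"
    by (subst integral_distr) auto
  also have "\<dots> \<ge> expectation (\<lambda>\<omega>. (dist (S \<omega>) b)\<^sup>2 + V)"
  proof (rule integral_mono)
    show "integrable M (\<lambda>\<omega>. (dist (S \<omega>) b)\<^sup>2 + V)"
      using int_S by simp
    show "integrable M (\<lambda>\<omega>. expectation (\<lambda>\<omega>'. (dist (S \<omega>) (Y \<omega>'))\<^sup>2))"
    proof (rule bounded[of _ "(2 * K)\<^sup>2"])
      show "(\<lambda>\<omega>. expectation (\<lambda>\<omega>'. (dist (S \<omega>) (Y \<omega>'))\<^sup>2)) \<in> borel_measurable M"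
        by measurable
      show "\<bar>expectation (\<lambda>\<omega>'. (dist (S \<omega>) (Y \<omega>'))\<^sup>2)\<bar> \<le> (2 * K)\<^sup>2" if "\<omega> \<in> space M" for \<omega>
      proof -
        have "expectation (\<lambda>\<omega>'. (dist (S \<omega>) (Y \<omega>'))\<^sup>2) \<le> (2 * K)\<^sup>2"
          using SY_le[OF that] by (intro integral_le_const bounded[of _ "(2 * K)\<^sup>2"] AE_I2) auto
        then show ?thesis by simp
      qed
    qed
  qed (rule V)
  also have "expectation (\<lambda>\<omega>. (dist (S \<omega>) b)\<^sup>2 + V) = expectation (\<lambda>\<omega>. (dist (S \<omega>) b)\<^sup>2) + V"
    using int_S by (simp add: prob_space)
  finally show ?thesis .
qed

text \<open>The mean is a measurable function of the block 1 to n, which is independent of the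
  disjoint block consisting of n + 1.\<close>

lemma (in prob_space) indep_var_inductive_mean:
  fixes X :: "nat \<Rightarrow> 'a \<Rightarrow> 'h::separable_hadamard_space"
  assumes "indep_vars (\<lambda>_. borel) X {1..}" and n: "n \<ge> 1"
  shows "indep_var borel (\<lambda>\<omega>. inductive_mean (\<lambda>i. X i \<omega>) n) borel (X (Suc n))"
proof -
  have "indep_var (PiM {1..n} (\<lambda>_. borel)) (\<lambda>\<omega>. \<lambda>i\<in>{1..n}. X i \<omega>)
      (PiM {Suc n} (\<lambda>_. borel)) (\<lambda>\<omega>. \<lambda>i\<in>{Suc n}. X i \<omega>)"
    by (rule indep_var_restrict[OF assms(1)]) auto
  moreover have "(\<lambda>x. inductive_mean (\<lambda>i. x i) n) \<in> PiM {1..n} (\<lambda>_. borel :: 'h measure) \<rightarrow>\<^sub>M borel"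
    by (rule borel_measurable_inductive_mean[OF n]) simp
  moreover have "(\<lambda>x. x (Suc n)) \<in> PiM {Suc n} (\<lambda>_. borel :: 'h measure) \<rightarrow>\<^sub>M borel"
    by simp
  ultimately have "indep_var borel ((\<lambda>x. inductive_mean (\<lambda>i. x i) n) \<circ> (\<lambda>\<omega>. \<lambda>i\<in>{1..n}. X i \<omega>))
      borel ((\<lambda>x. x (Suc n)) \<circ> (\<lambda>\<omega>. \<lambda>i\<in>{Suc n}. X i \<omega>))"
    by (rule indep_var_compose)
  moreover have "inductive_mean (\<lambda>i\<in>{1..n}. X i \<omega>) n = inductive_mean (\<lambda>i. X i \<omega>) n" for \<omega>
    by (rule inductive_mean_cong[OF n]) simp
  ultimately show ?thesis
    by (simp add: comp_def)
qed

text \<open>As for the variance of an arithmetic mean, n E[d(s_n,b)^2] <= V by induction. The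
  negative term of the curvature inequality plays the part of orthogonality.\<close>

lemma expectation_dist_inductive_mean_barycenter_le:
  fixes X :: "nat \<Rightarrow> 'w \<Rightarrow> 'h::separable_hadamard_space"
  assumes P: "prob_space P" and X: "\<And>i. i \<ge> 1 \<Longrightarrow> X i \<in> borel_measurable P"
    and iid: "iid P X" and K: "\<And>i \<omega>. i \<ge> 1 \<Longrightarrow> dist q (X i \<omega>) \<le> K" and n: "n \<ge> 1"
  defines "b \<equiv> barycenter P (X 1)"
  shows "(\<integral>\<omega>. (dist (inductive_mean (\<lambda>i. X i \<omega>) n) b)\<^sup>2 \<partial>P) \<le> 9 * K\<^sup>2 / real n"
proof -
  interpret prob_space P by fact
  define S where "S n \<omega> = inductive_mean (\<lambda>i. X i \<omega>) n" for n \<omega>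
  define V where "V = expectation (\<lambda>\<omega>. (dist b (X 1 \<omega>))\<^sup>2)"
  have "0 \<le> K"
    using K[of 1] zero_le_dist order_trans by blast
  have X1[measurable]: "X (Suc 0) \<in> borel_measurable P" "X 1 \<in> borel_measurable P"
    by (simp_all add: X)
  have S_meas: "S n \<in> borel_measurable P" if "n \<ge> 1" for n
    unfolding S_def using X by (intro borel_measurable_inductive_mean[OF that]) auto
  have bounded: "integrable P g" if "g \<in> borel_measurable P" "\<And>\<omega>. \<bar>g \<omega>\<bar> \<le> C"
    for g :: "'w \<Rightarrow> real" and C
    using that by (intro integrable_const_bound[where B=C]) auto
  have "integrable P (\<lambda>\<omega>. dist q (X 1 \<omega>))"
    by (rule bounded[of _ K]) (use K in auto)
  then interpret I: integrable_rv P "X 1" q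
    by unfold_locales auto
  have qb: "dist q b \<le> 2 * K"
  proof -
    have "expectation (\<lambda>\<omega>. dist q (X 1 \<omega>)) \<le> K"
      using K by (intro integral_le_const I.int AE_I2) auto
    then show ?thesis
      using I.dist_barycenter_le by (simp add: b_def)
  qed
  have S_le: "dist q (S n \<omega>) \<le> K" if "n \<ge> 1" for n \<omega>
    unfolding S_def using K by (intro inductive_mean_in_cball[OF that])
  have sq_le: "(dist z y)\<^sup>2 \<le> (dist q z + K)\<^sup>2" if "dist q y \<le> K" for z y
    using that dist_triangle3[of z y q] by (intro power_mono) auto
  have int_X: "integrable P (\<lambda>\<omega>. (dist z (X i \<omega>))\<^sup>2)" if "i \<ge> 1" for z i
    using sq_le K that X[OF that] by (intro bounded[of _ "(dist q z + K)\<^sup>2"]) auto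
  have int_S: "integrable P (\<lambda>\<omega>. (dist (S n \<omega>) z)\<^sup>2)" if "n \<ge> 1" for z n
    using sq_le[OF S_le] that S_meas[OF that]
    by (intro bounded[of _ "(dist q z + K)\<^sup>2"]) (auto simp: dist_commute[of "S n _" z])
  have int_SX: "integrable P (\<lambda>\<omega>. (dist (S n \<omega>) (X (Suc n) \<omega>))\<^sup>2)" if "n \<ge> 1" for n
  proof (rule bounded[of _ "(2 * K)\<^sup>2"])
    show "\<bar>(dist (S n \<omega>) (X (Suc n) \<omega>))\<^sup>2\<bar> \<le> (2 * K)\<^sup>2" for \<omega>
      unfolding abs_power2
      using dist_triangle3[of "S n \<omega>" "X (Suc n) \<omega>" q] S_le[OF that, of \<omega>] K[of "Suc n" \<omega>]
      by (intro power_mono) auto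
  qed (use that X S_meas in simp)
  have EX: "expectation (\<lambda>\<omega>. (dist z (X i \<omega>))\<^sup>2) = expectation (\<lambda>\<omega>. (dist z (X 1 \<omega>))\<^sup>2)"
    if "i \<ge> 1" for z i
    by (rule iid_expectation_eq[OF X iid _ that]) measurable
  have var: "(dist z b)\<^sup>2 + V \<le> expectation (\<lambda>\<omega>. (dist z (X i \<omega>))\<^sup>2)" if "i \<ge> 1" for z i
    using I.barycenter_variance[of z] int_X[of 1]
    by (simp add: EX[OF that] V_def b_def)
  \<comment> \<open>The barycenter is within 2K of \<open>q\<close> and \<open>X 1\<close> within K,
    hence the factor 9 in the final bound.\<close>
  have "V \<le> (3 * K)\<^sup>2"
    unfolding V_def
  proof (rule integral_le_const[OF int_X], simp, rule AE_I2)
    fix \<omega>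
    show "(dist b (X 1 \<omega>))\<^sup>2 \<le> (3 * K)\<^sup>2"
      using qb K[of 1 \<omega>] dist_triangle3[of b "X 1 \<omega>" q] by (intro power_mono) auto
  qed
  have "real n * expectation (\<lambda>\<omega>. (dist (S n \<omega>) b)\<^sup>2) \<le> V"
    using n
  proof (induction n rule: nat_induct_at_least)
    case base
    then show ?case
      by (simp add: S_def V_def dist_commute)
  next
    case (Suc n)
    define t where "t = 1 / real (Suc n)"
    define a where "a = expectation (\<lambda>\<omega>. (dist (S n \<omega>) b)\<^sup>2)"
    have t: "0 \<le> t" "t \<le> 1"
      by (auto simp: t_def)
    have "expectation (\<lambda>\<omega>. (dist (S (Suc n) \<omega>) b)\<^sup>2) \<le> expectation (\<lambda>\<omega>. (1 - t) * (dist (S n \<omega>) b)\<^sup>2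
      + t * (dist b (X (Suc n) \<omega>))\<^sup>2 - t * (1 - t) * (dist (S n \<omega>) (X (Suc n) \<omega>))\<^sup>2)"
    proof (rule integral_mono)
      fix \<omega>
      show "(dist (S (Suc n) \<omega>) b)\<^sup>2 \<le> (1 - t) * (dist (S n \<omega>) b)\<^sup>2
        + t * (dist b (X (Suc n) \<omega>))\<^sup>2 - t * (1 - t) * (dist (S n \<omega>) (X (Suc n) \<omega>))\<^sup>2"
        unfolding S_def inductive_mean_Suc[OF Suc.hyps] t_def[symmetric]
        using geodesic_point_dist_le[OF t] by (simp add: dist_commute[of b])
      show "integrable P (\<lambda>\<omega>. (dist (S (Suc n) \<omega>) b)\<^sup>2)"
        by (rule int_S) simp
      show "integrable P (\<lambda>\<omega>. (1 - t) * (dist (S n \<omega>) b)\<^sup>2 + t * (dist b (X (Suc n) \<omega>))\<^sup>2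
        - t * (1 - t) * (dist (S n \<omega>) (X (Suc n) \<omega>))\<^sup>2)"
        using Suc.hyps by (intro Bochner_Integration.integrable_diff Bochner_Integration.integrable_add
            integrable_mult_right int_S int_X int_SX) auto
    qed
    also have "\<dots> = (1 - t) * a + t * V - t * (1 - t) * expectation (\<lambda>\<omega>. (dist (S n \<omega>) (X (Suc n) \<omega>))\<^sup>2)"
      using int_S[OF Suc.hyps] int_SX[OF Suc.hyps] int_X[of "Suc n"] EX[of "Suc n"]
      by (simp add: a_def V_def)
    \<comment> \<open>Independence and the variance inequality bound the subtracted expectation
      below by a + V, which leaves (1-t)^2 a + t^2 V.\<close>
    also have "\<dots> \<le> (1 - t) * a + t * V - t * (1 - t) * (a + V)"
    proof (intro diff_left_mono mult_left_mono)
      show "a + V \<le> expectation (\<lambda>\<omega>. (dist (S n \<omega>) (X (Suc n) \<omega>))\<^sup>2)"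
        unfolding a_def
        using Suc.hyps S_le K var indep_var_inductive_mean[OF iid_imp_indep_vars[OF iid] Suc.hyps]
        by (intro expectation_dist_power2_indep_ge[where q=q and K=K]) (auto simp: S_def[abs_def])
    qed (use t in auto)
    also have "\<dots> = (1 - t)\<^sup>2 * a + t\<^sup>2 * V"
      by (simp add: power2_eq_square algebra_simps)
    finally have "real (Suc n) * expectation (\<lambda>\<omega>. (dist (S (Suc n) \<omega>) b)\<^sup>2) \<le>
        real (Suc n) * ((1 - t)\<^sup>2 * a + t\<^sup>2 * V)"
      by (intro mult_left_mono) auto
    \<comment> \<open>With t = 1/(n+1), one factor 1 - t becomes n and one factor t becomes 1, so
      the induction hypothesis n a <= V applies.\<close>
    also have "\<dots> = (1 - t) * (real n * a) + t * V"
    proof -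
      have "real (Suc n) * (1 - t) = real n" "real (Suc n) * t = 1"
        by (auto simp: t_def field_simps)
      then show ?thesis
        by (simp only: power2_eq_square distrib_left mult.assoc[symmetric]) (simp add: mult.commute mult.left_commute)
    qed
    also have "\<dots> \<le> (1 - t) * V + t * V"
      using Suc.IH t by (intro add_mono mult_left_mono) (auto simp: a_def)
    finally show ?case
      by (simp add: algebra_simps)
  qed
  with \<open>V \<le> (3 * K)\<^sup>2\<close> n show ?thesis
    by (simp add: S_def field_simps power_mult_distrib)
qed


text \<open>Markov's inequality along square times gives summable probabilities, and the means move
  little between squares. All bounds involve only \<open>K\<close>, \<open>\<epsilon>\<close> and
  \<open>\<eta>\<close>, so \<open>m0\<close> is chosen before the measure and the sequence.\<close>

lemma uniform_slln_inductive_mean_bounded: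
  fixes q :: "'h::separable_hadamard_space"
  assumes \<epsilon>: "\<epsilon> > 0" and \<eta>: "\<eta> > 0" and K0: "K > 0"
  shows "\<exists>m0\<ge>1. \<forall>(P :: 'w measure) X. \<forall>m\<ge>m0. prob_space P \<longrightarrow> (\<forall>i\<ge>1. X i \<in> borel_measurable P) \<longrightarrow>
    iid P X \<longrightarrow> (\<forall>i\<ge>1. \<forall>\<omega>. dist q (X i \<omega>) \<le> K) \<longrightarrow>
    measure P {\<omega>\<in>space P. \<exists>n\<ge>m. \<epsilon> < dist (inductive_mean (\<lambda>i. X i \<omega>) n) (barycenter P (X 1))} \<le> \<eta>"
proof -
  \<comment> \<open>The Markov bound for a deviation of at least \<epsilon>/2 at time k^2: 9K^2/k^2
    divided by \<epsilon>^2/4.\<close>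
  define f where "f k = 36 * K\<^sup>2 / \<epsilon>\<^sup>2 * inverse (real k ^ 2)" for k
  have f0: "0 \<le> f k" for k
    by (simp add: f_def)
  have f: "summable f"
    unfolding f_def by (intro summable_mult inverse_power_summable) simp
  then obtain N where N: "\<And>k. k \<ge> N \<Longrightarrow> norm (\<Sum>i. f (i + k)) < \<eta>"
    using suminf_exist_split[OF \<eta>] by blast
  \<comment> \<open>Beyond \<open>N\<close> the tail of \<open>f\<close> is below \<eta>, and k >=
    8K/\<epsilon> makes the movement 4K/k between squares at most \<epsilon>/2.\<close>
  define k0 where "k0 = max (max N 1) (nat \<lceil>8 * K / \<epsilon>\<rceil>)"
  have k0: "k0 \<ge> N" "k0 \<ge> 1" and k0_K: "8 * K / \<epsilon> \<le> real k0"
    unfolding k0_def by linarith+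
  show ?thesis
  proof (intro exI[of _ "k0\<^sup>2"] conjI allI impI)
    show "1 \<le> k0\<^sup>2"
      using k0 by (simp add: one_le_power)
    fix P :: "'w measure" and X :: "nat \<Rightarrow> 'w \<Rightarrow> 'h" and m
    assume m: "k0\<^sup>2 \<le> m" and P: "prob_space P" and X': "\<forall>i\<ge>1. X i \<in> borel_measurable P"
      and iid: "iid P X" and K': "\<forall>i\<ge>1. \<forall>\<omega>. dist q (X i \<omega>) \<le> K"
    have X: "X i \<in> borel_measurable P" and K: "dist q (X i \<omega>) \<le> K" if "i \<ge> 1" for i \<omega>
      using X' K' that by blast+
    interpret prob_space P by fact
    define S where "S n \<omega> = inductive_mean (\<lambda>i. X i \<omega>) n" for n \<omega>
    define b where "b = barycenter P (X 1)"
    define A where "A i = {\<omega>\<in>space P. \<epsilon>\<^sup>2 / 4 \<le> (dist (S ((i + k0)\<^sup>2) \<omega>) b)\<^sup>2}" for i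
    have sq1: "1 \<le> (i + k0)\<^sup>2" for i
      using k0 by (simp add: one_le_power)
    have S_meas: "S n \<in> borel_measurable P" if "n \<ge> 1" for n
      unfolding S_def using X by (intro borel_measurable_inductive_mean[OF that]) auto
    have A_sets: "A i \<in> sets P" for i
      unfolding A_def using S_meas[OF sq1] by measurable
    have A_prob: "prob (A i) \<le> f (i + k0)" for i
    proof -
      let ?n = "(i + k0)\<^sup>2"
      have "integrable P (\<lambda>\<omega>. (dist (S ?n \<omega>) b)\<^sup>2)"
      proof (rule integrable_const_bound[where B="(K + dist q b)\<^sup>2"], rule AE_I2)
        fix \<omega>
        have "dist q (S ?n \<omega>) \<le> K"
          unfolding S_def using K by (intro inductive_mean_in_cball[OF sq1])
        then have "(dist (S ?n \<omega>) b)\<^sup>2 \<le> (K + dist q b)\<^sup>2"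
          using dist_triangle3[of "S ?n \<omega>" b q] by (intro power_mono) auto
        then show "norm ((dist (S ?n \<omega>) b)\<^sup>2) \<le> (K + dist q b)\<^sup>2"
          by simp
      qed (use S_meas[OF sq1] in measurable)
      then have "prob (A i) \<le> expectation (\<lambda>\<omega>. (dist (S ?n \<omega>) b)\<^sup>2) / (\<epsilon>\<^sup>2 / 4)"
        unfolding A_def using \<epsilon> by (intro integral_Markov_inequality_measure[where A="{}"]) auto
      also have "\<dots> \<le> (9 * K\<^sup>2 / real ?n) / (\<epsilon>\<^sup>2 / 4)"
        unfolding S_def b_def using \<epsilon>
        by (intro divide_right_mono expectation_dist_inductive_mean_barycenter_le[OF P X iid K sq1]) auto
      also have "\<dots> = f (i + k0)"
        by (simp add: f_def field_simps)
      finally show ?thesis .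
    qed
    have "summable (\<lambda>i. f (i + k0))"
      using f by (simp only: summable_iff_shift)
    then have summ: "summable (\<lambda>i. prob (A i))"
      by (rule summable_comparison_test'[where N=0]) (use A_prob in simp)
    have sub: "{\<omega>\<in>space P. \<exists>n\<ge>m. \<epsilon> < dist (S n \<omega>) b} \<subseteq> (\<Union>i. A i)"
    proof safe
      fix \<omega> n assume \<omega>: "\<omega> \<in> space P" and n: "n \<ge> m" and gt: "\<epsilon> < dist (S n \<omega>) b"
      \<comment> \<open>The last square not exceeding n lies fewer than 2k + 1 steps back, and each
        step has length at most 2K/k^2.\<close>
      define k where "k = floor_sqrt n"
      have k: "k\<^sup>2 \<le> n" "n < (Suc k)\<^sup>2"
        unfolding k_def by (simp_all add: Suc_floor_sqrt_power2_gt)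
      have "k0\<^sup>2 < (Suc k)\<^sup>2"
        using k m n by linarith
      then have "k0 \<le> k"
        using power_less_imp_less_base by fastforce
      then have "k \<ge> 1" "1 \<le> k\<^sup>2"
        using k0 by (simp_all add: one_le_power)
      have "dist (S (k\<^sup>2) \<omega>) (S n \<omega>) \<le> real (n - k\<^sup>2) * (2 * K / real (k\<^sup>2))"
        using dist_inductive_mean_add_le[of "k\<^sup>2" q "\<lambda>i. X i \<omega>" K "n - k\<^sup>2", OF \<open>1 \<le> k\<^sup>2\<close> K] k
        by (simp add: S_def)
      also have "\<dots> \<le> real (2 * k) * (2 * K / real (k\<^sup>2))"
      proof (intro mult_right_mono of_nat_mono)
        show "n - k\<^sup>2 \<le> 2 * k"
          using k by (simp add: power2_eq_square)
      qed (use K0 in simp)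
      also have "\<dots> = 4 * K / real k"
        using \<open>k \<ge> 1\<close> by (simp add: power2_eq_square)
      also have "\<dots> \<le> \<epsilon> / 2"
      proof -
        have "8 * K / \<epsilon> \<le> real k"
          using k0_K \<open>k0 \<le> k\<close> by linarith
        then show ?thesis
          using \<epsilon> \<open>k \<ge> 1\<close> by (simp add: field_simps)
      qed
      finally have "\<epsilon> / 2 \<le> dist (S (k\<^sup>2) \<omega>) b"
        using gt dist_triangle3[of "S n \<omega>" b "S (k\<^sup>2) \<omega>"] by linarith
      then have "(\<epsilon> / 2)\<^sup>2 \<le> (dist (S (k\<^sup>2) \<omega>) b)\<^sup>2"
        using \<epsilon> by (intro power_mono) auto
      then have "\<omega> \<in> A (k - k0)"
        using \<omega> \<open>k0 \<le> k\<close> by (simp add: A_def power_divide)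
      then show "\<omega> \<in> (\<Union>i. A i)"
        by blast
    qed
    then have "prob {\<omega>\<in>space P. \<exists>n\<ge>m. \<epsilon> < dist (S n \<omega>) b} \<le> prob (\<Union>i. A i)"
      using A_sets by (intro finite_measure_mono) auto
    also have "\<dots> \<le> (\<Sum>i. prob (A i))"
      using A_sets summ by (intro finite_measure_subadditive_countably) auto
    also have "\<dots> \<le> (\<Sum>i. f (i + k0))"
      using A_prob summ \<open>summable (\<lambda>i. f (i + k0))\<close> by (rule suminf_le)
    also have "\<dots> \<le> \<eta>"
      using N[OF k0(1)] by simp
    finally show "prob {\<omega>\<in>space P. \<exists>n\<ge>m. \<epsilon> < dist (inductive_mean (\<lambda>i. X i \<omega>) n) (barycenter P (X 1))} \<le> \<eta>"
      by (simp add: S_def b_def)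
  qed
qed

section \<open>Truncation\<close>

text \<open>Far points are sent to the centre instead of the boundary, so the truncation error is
  exactly d(q,x) on d(q,x) >= K and 0 elsewhere: the integrand of uniform integrability.\<close>

definition truncate :: "'h::metric_space \<Rightarrow> real \<Rightarrow> 'h \<Rightarrow> 'h" where
  "truncate q K x = (if dist q x < K then x else q)"

lemma borel_measurable_truncate[measurable]:
  fixes q :: "'h::{second_countable_topology, metric_space}"
  shows "truncate q K \<in> borel_measurable borel"
  unfolding truncate_def[abs_def] by measurable

lemma dist_truncate_le: "0 \<le> K \<Longrightarrow> dist q (truncate q K x) \<le> K"
  by (simp add: truncate_def)

text \<open>Add the variance inequalities of X at the barycenter of Y and of Y at that of X. The
  resulting integrand vanishes where X = Y and carries a factor d(b,c) elsewhere, which cancels one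
  factor on the left.\<close>

lemma dist_barycenter_truncate_le:
  fixes X :: "'w \<Rightarrow> 'h::separable_hadamard_space"
  assumes P: "prob_space P" and X[measurable]: "X \<in> borel_measurable P"
    and int: "integrable P (\<lambda>\<omega>. dist q (X \<omega>))" and K: "4 * (\<integral>\<omega>. dist q (X \<omega>) \<partial>P) \<le> K"
  shows "dist (barycenter P X) (barycenter P (\<lambda>\<omega>. truncate q K (X \<omega>)))
    \<le> 2 * (\<integral>\<omega>. dist (X \<omega>) (truncate q K (X \<omega>)) \<partial>P)"
proof -
  interpret prob_space P by fact
  let ?m = "expectation (\<lambda>\<omega>. dist q (X \<omega>))"
  define Y where "Y \<omega> = truncate q K (X \<omega>)" for \<omega>
  have [measurable]: "Y \<in> borel_measurable P"
    unfolding Y_def[abs_def] by measurable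
  have m: "0 \<le> ?m"
    by simp
  have qY: "dist q (Y \<omega>) \<le> dist q (X \<omega>)" for \<omega>
    by (simp add: Y_def truncate_def)
  have int_Y: "integrable P (\<lambda>\<omega>. dist q (Y \<omega>))"
    by (rule Bochner_Integration.integrable_bound[OF int]) (use qY in auto)
  have int_XY: "integrable P (\<lambda>\<omega>. dist (X \<omega>) (Y \<omega>))"
    by (rule Bochner_Integration.integrable_bound[OF int]) (auto simp: Y_def truncate_def dist_commute)
  interpret X: integrable_rv P X q
    by unfold_locales (use int in auto)
  interpret Y: integrable_rv P Y q
    by unfold_locales (use int_Y in auto)
  define b c where "b = barycenter P X" and "c = barycenter P Y"
  have qb: "dist q b \<le> 2 * ?m"
    unfolding b_def by (rule X.dist_barycenter_le)
  have "expectation (\<lambda>\<omega>. dist q (Y \<omega>)) \<le> ?m"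
    using qY int int_Y by (intro integral_mono)
  then have qc: "dist q c \<le> 2 * ?m"
    using Y.dist_barycenter_le by (simp add: c_def)
  have "2 * (dist b c)\<^sup>2 \<le> (\<integral>\<omega>. (dist c (X \<omega>))\<^sup>2 - (dist b (X \<omega>))\<^sup>2 \<partial>P) + (\<integral>\<omega>. (dist b (Y \<omega>))\<^sup>2 - (dist c (Y \<omega>))\<^sup>2 \<partial>P)"
    using X.barycenter_variance[of c] Y.barycenter_variance[of b]
    by (simp add: b_def[symmetric] c_def[symmetric] dist_commute[of c b])
  also have "\<dots> = (\<integral>\<omega>. ((dist c (X \<omega>))\<^sup>2 - (dist b (X \<omega>))\<^sup>2) + ((dist b (Y \<omega>))\<^sup>2 - (dist c (Y \<omega>))\<^sup>2) \<partial>P)"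
    by (rule Bochner_Integration.integral_add[symmetric])
       (rule X.integrable_dist_power2_diff Y.integrable_dist_power2_diff)+
  also have "\<dots> \<le> (\<integral>\<omega>. dist b c * (4 * dist (X \<omega>) (Y \<omega>)) \<partial>P)"
  proof (rule integral_mono)
    fix \<omega>
    show "((dist c (X \<omega>))\<^sup>2 - (dist b (X \<omega>))\<^sup>2) + ((dist b (Y \<omega>))\<^sup>2 - (dist c (Y \<omega>))\<^sup>2)
      \<le> dist b c * (4 * dist (X \<omega>) (Y \<omega>))"
    proof (cases "dist q (X \<omega>) < K")
      case True
      then show ?thesis by (simp add: Y_def truncate_def)
    next
      case False
      then have Y: "Y \<omega> = q"
        by (simp add: Y_def truncate_def)
      have "(dist c (X \<omega>))\<^sup>2 - (dist b (X \<omega>))\<^sup>2 \<le> dist b c * (dist c (X \<omega>) + dist b (X \<omega>))"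
        using abs_dist_power2_diff_le[of c "X \<omega>" b] by (simp add: dist_commute[of c b])
      moreover have "(dist b q)\<^sup>2 - (dist c q)\<^sup>2 \<le> dist b c * (dist b q + dist c q)"
        using abs_dist_power2_diff_le[of b q c] by simp
      ultimately have "((dist c (X \<omega>))\<^sup>2 - (dist b (X \<omega>))\<^sup>2) + ((dist b q)\<^sup>2 - (dist c q)\<^sup>2)
        \<le> dist b c * (dist c (X \<omega>) + dist b (X \<omega>) + (dist b q + dist c q))"
        by (simp add: distrib_left)
      \<comment> \<open>By the triangle inequality the bracket is at most 2d(X,q) + 2d(b,q) +
        2d(c,q). The last two terms sum to at most 8m <= 2K <= 2d(X,q), where m is the first
        moment.\<close>
      also have "\<dots> \<le> dist b c * (4 * dist (X \<omega>) q)"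
        using dist_triangle3[of c "X \<omega>" q] dist_triangle3[of b "X \<omega>" q] qb qc K False
        by (intro mult_left_mono) (simp_all add: dist_commute[of _ q])
      finally show ?thesis
        by (simp add: Y)
    qed
  qed (intro Bochner_Integration.integrable_add X.integrable_dist_power2_diff
      Y.integrable_dist_power2_diff integrable_mult_right int_XY)+
  also have "\<dots> = dist b c * (4 * expectation (\<lambda>\<omega>. dist (X \<omega>) (Y \<omega>)))"
    by simp
  finally have "dist b c * dist b c \<le> dist b c * (2 * expectation (\<lambda>\<omega>. dist (X \<omega>) (Y \<omega>)))"
    by (simp add: power2_eq_square)
  then have "dist b c \<le> 2 * expectation (\<lambda>\<omega>. dist (X \<omega>) (Y \<omega>))"
    by (cases "dist b c = 0") (auto simp: mult_le_cancel_left)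
  then show ?thesis
    by (simp add: b_def c_def Y_def[abs_def])
qed

text \<open>Split \<epsilon> into thirds: means of X against means of Y (maximal inequality), means
  of Y against their barycenter (the remaining probability), and the two barycenters, which are
  within 2\<delta> <= \<epsilon>/3.\<close>

lemma prob_inductive_mean_deviation_le:
  fixes X :: "nat \<Rightarrow> 'w \<Rightarrow> 'h::separable_hadamard_space"
  assumes P: "prob_space P" and X: "\<And>i. i \<ge> 1 \<Longrightarrow> X i \<in> borel_measurable P"
    and iid: "iid P X" and int: "integrable P (\<lambda>\<omega>. dist q (X 1 \<omega>))"
    and K: "4 * (\<integral>\<omega>. dist q (X 1 \<omega>) \<partial>P) \<le> K"
    and \<delta>: "(\<integral>\<omega>. dist (X 1 \<omega>) (truncate q K (X 1 \<omega>)) \<partial>P) \<le> \<delta>" "6 * \<delta> \<le> \<epsilon>"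
    and \<epsilon>: "\<epsilon> > 0" and m: "m \<ge> 1"
  defines "Y \<equiv> \<lambda>i \<omega>. truncate q K (X i \<omega>)"
  shows "measure P {\<omega>\<in>space P. \<exists>n\<ge>m. \<epsilon> < dist (inductive_mean (\<lambda>i. X i \<omega>) n) (barycenter P (X 1))}
    \<le> 3 * \<delta> / \<epsilon> + measure P {\<omega>\<in>space P. \<exists>n\<ge>m. \<epsilon> / 3 < dist (inductive_mean (\<lambda>i. Y i \<omega>) n) (barycenter P (Y 1))}"
proof -
  interpret prob_space P by fact
  define Z where "Z i \<omega> = dist (X i \<omega>) (Y i \<omega>)" for i \<omega>
  have Y: "Y i \<in> borel_measurable P" if "i \<ge> 1" for i
    unfolding Y_def using X[OF that] by measurable
  have Z: "Z i \<in> borel_measurable P" if "i \<ge> 1" for i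
    unfolding Z_def[abs_def] using X[OF that] Y[OF that] by measurable
  have "iid P (\<lambda>i \<omega>. dist (X i \<omega>) (truncate q K (X i \<omega>)))"
    by (rule iid_compose[OF P X iid]) measurable
  then have Z_iid: "iid P Z"
    by (simp add: Z_def[abs_def] Y_def)
  have Z_int: "integrable P (Z 1)"
    by (rule Bochner_Integration.integrable_bound[OF int])
       (use Z in \<open>auto simp: Z_def Y_def truncate_def dist_commute\<close>)
  let ?A = "{\<omega>\<in>space P. \<exists>n\<ge>1. \<epsilon> / 3 * real n < (\<Sum>i<n. Z (Suc i) \<omega>)}"
  let ?B = "{\<omega>\<in>space P. \<exists>n\<ge>m. \<epsilon> / 3 < dist (inductive_mean (\<lambda>i. Y i \<omega>) n) (barycenter P (Y 1))}"
  have "\<epsilon> / 3 * prob ?A \<le> expectation (Z 1)"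
    by (rule iid_maximal_inequality[OF P Z Z_iid _ Z_int]) (use \<epsilon> in \<open>auto simp: Z_def\<close>)
  then have A: "prob ?A \<le> 3 * \<delta> / \<epsilon>"
    using \<delta>(1) \<epsilon> by (simp add: Z_def[abs_def] Y_def field_simps)
  have Zm[measurable]: "Z (Suc i) \<in> borel_measurable P" for i
    by (rule Z) simp
  have A_sets: "?A \<in> sets P"
    by measurable
  have B_sets: "?B \<in> sets P"
  proof -
    have "?B = (\<Union>n\<in>{m..}. {\<omega>\<in>space P. \<epsilon> / 3 < dist (inductive_mean (\<lambda>i. Y i \<omega>) n) (barycenter P (Y 1))})"
      by auto
    also have "\<dots> \<in> sets P"
    proof (rule sets.countable_UN'')
      fix n assume "n \<in> {m..}"
      then have [measurable]: "(\<lambda>\<omega>. inductive_mean (\<lambda>i. Y i \<omega>) n) \<in> borel_measurable P"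
        using m Y by (intro borel_measurable_inductive_mean) auto
      show "{\<omega>\<in>space P. \<epsilon> / 3 < dist (inductive_mean (\<lambda>i. Y i \<omega>) n) (barycenter P (Y 1))} \<in> sets P"
        by measurable
    qed auto
    finally show ?thesis .
  qed
  have bary: "dist (barycenter P (X 1)) (barycenter P (Y 1)) \<le> \<epsilon> / 3"
    using dist_barycenter_truncate_le[OF P X int K] \<delta> by (simp add: Y_def)
  have "{\<omega>\<in>space P. \<exists>n\<ge>m. \<epsilon> < dist (inductive_mean (\<lambda>i. X i \<omega>) n) (barycenter P (X 1))} \<subseteq> ?A \<union> ?B"
  proof (rule subsetI)
    fix \<omega> assume "\<omega> \<in> {\<omega>\<in>space P. \<exists>n\<ge>m. \<epsilon> < dist (inductive_mean (\<lambda>i. X i \<omega>) n) (barycenter P (X 1))}"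
    then obtain n where n: "\<omega> \<in> space P" "n \<ge> m" "\<epsilon> < dist (inductive_mean (\<lambda>i. X i \<omega>) n) (barycenter P (X 1))"
      by blast
    let ?x = "inductive_mean (\<lambda>i. X i \<omega>) n" and ?y = "inductive_mean (\<lambda>i. Y i \<omega>) n"
    have n1: "n \<ge> 1"
      using n m by simp
    show "\<omega> \<in> ?A \<union> ?B"
    proof (cases "\<epsilon> / 3 < dist ?y (barycenter P (Y 1))")
      case True
      then show ?thesis using n by blast
    next
      case False
      then have "\<epsilon> / 3 < dist ?x ?y"
        using n(3) bary dist_triangle[of ?x "barycenter P (X 1)" ?y]
          dist_triangle2[of ?y "barycenter P (X 1)" "barycenter P (Y 1)"] by linarith
      then have "\<epsilon> / 3 * real n < real n * dist ?x ?y"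
        using n1 by simp
      also have "\<dots> \<le> (\<Sum>i<n. Z (Suc i) \<omega>)"
        unfolding Z_def by (rule dist_inductive_mean_le_sum[OF n1])
      finally show ?thesis
        using n(1) n1 by blast
    qed
  qed
  then have "prob {\<omega>\<in>space P. \<exists>n\<ge>m. \<epsilon> < dist (inductive_mean (\<lambda>i. X i \<omega>) n) (barycenter P (X 1))} \<le> prob (?A \<union> ?B)"
    by (rule finite_measure_mono[OF _ sets.Un[OF A_sets B_sets]])
  also have "\<dots> \<le> prob ?A + prob ?B"
    by (rule measure_Un_le[OF A_sets B_sets])
  finally show ?thesis
    using A by linarith
qed

text \<open>The truncation error coincides with the tail integrand in the definition of uniform
  integrability. Working with nonnegative integrals first yields its integrability as well.\<close>

lemma uniformly_integrable_wrt_truncate: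
  fixes X :: "'w \<Rightarrow> 'h::separable_hadamard_space"
  assumes UI: "uniformly_integrable_wrt \<P> q X" and \<delta>: "\<delta> > 0"
    and P: "\<And>P. P \<in> \<P> \<Longrightarrow> prob_space P" and X: "\<And>P. P \<in> \<P> \<Longrightarrow> X \<in> borel_measurable P"
  shows "\<forall>\<^sub>F K in at_top. \<forall>P\<in>\<P>. integrable P (\<lambda>\<omega>. dist (X \<omega>) (truncate q K (X \<omega>))) \<and>
    (\<integral>\<omega>. dist (X \<omega>) (truncate q K (X \<omega>)) \<partial>P) \<le> \<delta>"
proof -
  have "\<forall>\<^sub>F K in at_top. (\<Squnion>P\<in>\<P>. \<integral>\<^sup>+\<omega>. ennreal (dist q (X \<omega>)) * indicator {\<omega>. dist q (X \<omega>) \<ge> K} \<omega> \<partial>P) < ennreal \<delta>"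
    using UI \<delta> unfolding uniformly_integrable_wrt_def by (intro order_tendstoD(2)) auto
  then show ?thesis
  proof eventually_elim
    case (elim K)
    show ?case
    proof
      fix P assume "P \<in> \<P>"
      note [measurable] = X[OF this]
      have "(\<integral>\<^sup>+\<omega>. ennreal (dist (X \<omega>) (truncate q K (X \<omega>))) \<partial>P) =
          (\<integral>\<^sup>+\<omega>. ennreal (dist q (X \<omega>)) * indicator {\<omega>. dist q (X \<omega>) \<ge> K} \<omega> \<partial>P)"
        by (intro nn_integral_cong) (auto simp: truncate_def dist_commute indicator_def)
      also have "\<dots> < ennreal \<delta>"
        using elim \<open>P \<in> \<P>\<close> by (meson SUP_upper le_less_trans)
      finally have less: "(\<integral>\<^sup>+\<omega>. ennreal (dist (X \<omega>) (truncate q K (X \<omega>))) \<partial>P) < ennreal \<delta>" .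
      have int: "integrable P (\<lambda>\<omega>. dist (X \<omega>) (truncate q K (X \<omega>)))"
        by (rule integrableI_nonneg) (use less in \<open>auto intro: less_trans simp: less_top[symmetric]\<close>)
      have "ennreal (\<integral>\<omega>. dist (X \<omega>) (truncate q K (X \<omega>)) \<partial>P) \<le> ennreal \<delta>"
        using less int by (subst nn_integral_eq_integral[symmetric]) auto
      then show "integrable P (\<lambda>\<omega>. dist (X \<omega>) (truncate q K (X \<omega>))) \<and>
          (\<integral>\<omega>. dist (X \<omega>) (truncate q K (X \<omega>)) \<partial>P) \<le> \<delta>"
        using int \<delta> by simp
    qed
  qed
qed

section \<open>From uniform integrability to the uniform law of large numbers\<close>

theorem corollary3p6:
  fixes F :: "'w measure"
    and \<P> :: "'w measure set"
    and X :: "nat \<Rightarrow> 'w \<Rightarrow> 'h::separable_hadamard_space"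
    and p :: 'h
    and \<epsilon> :: real
  assumes "\<And>P. P \<in> \<P> \<Longrightarrow> prob_space P \<and> sets P = sets F"
    and "\<And>i. i \<ge> 1 \<Longrightarrow> X i \<in> F \<rightarrow>\<^sub>M borel"
    and "\<And>P. P \<in> \<P> \<Longrightarrow> iid P X"
    and "uniformly_integrable_wrt \<P> p (X 1)"
    and "\<epsilon> > 0"
  shows "(\<lambda>m. \<Squnion>P\<in>\<P>. emeasure P
            {\<omega> \<in> space F. (\<Squnion>n\<in>{m..}. ennreal (dist (inductive_mean (\<lambda>i. X i \<omega>) n)
                                              (barycenter P (X 1)))) > ennreal \<epsilon>})
         \<longlonglongrightarrow> 0"
proof -
  have P: "prob_space P" and sets_P: "sets P = sets F" and iid: "iid P X" if "P \<in> \<P>" for P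
    using assms(1,3) that by auto
  have X: "X i \<in> borel_measurable P" if "P \<in> \<P>" "i \<ge> 1" for P i
    using assms(2)[OF that(2)] measurable_cong_sets[OF sets_P[OF that(1)] refl] by blast
  note trunc = uniformly_integrable_wrt_truncate[OF assms(4) _ P X[OF _ order_refl]]
  \<comment> \<open>One truncation level with error at most 1 bounds all first moments by K1 + 1,
    uniformly over the measures.\<close>
  obtain K1 where K1: "\<And>P. P \<in> \<P> \<Longrightarrow> integrable P (\<lambda>\<omega>. dist (X 1 \<omega>) (truncate p K1 (X 1 \<omega>)))"
      "\<And>P. P \<in> \<P> \<Longrightarrow> (\<integral>\<omega>. dist (X 1 \<omega>) (truncate p K1 (X 1 \<omega>)) \<partial>P) \<le> 1" and "K1 > 0"
    using eventually_happens[OF eventually_conj[OF trunc[of 1] eventually_gt_at_top[of 0]]] by auto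
  have moment: "integrable P (\<lambda>\<omega>. dist p (X 1 \<omega>))" "(\<integral>\<omega>. dist p (X 1 \<omega>) \<partial>P) \<le> K1 + 1" if "P \<in> \<P>" for P
  proof -
    interpret prob_space P by (rule P[OF that])
    have [measurable]: "(\<lambda>\<omega>. dist p (X 1 \<omega>)) \<in> borel_measurable P"
      using X[OF that order_refl] by measurable
    have le: "dist p (X 1 \<omega>) \<le> K1 + dist (X 1 \<omega>) (truncate p K1 (X 1 \<omega>))" for \<omega>
      using \<open>K1 > 0\<close> by (simp add: truncate_def dist_commute)
    have int: "integrable P (\<lambda>\<omega>. K1 + dist (X 1 \<omega>) (truncate p K1 (X 1 \<omega>)))"
      using K1(1)[OF that] by simp
    show int_p: "integrable P (\<lambda>\<omega>. dist p (X 1 \<omega>))"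
      by (rule Bochner_Integration.integrable_bound[OF int]) (use le \<open>K1 > 0\<close> in \<open>auto simp del: One_nat_def\<close>)
    have "(\<integral>\<omega>. dist p (X 1 \<omega>) \<partial>P) \<le> (\<integral>\<omega>. K1 + dist (X 1 \<omega>) (truncate p K1 (X 1 \<omega>)) \<partial>P)"
      by (rule integral_mono[OF int_p int le])
    also have "\<dots> \<le> K1 + 1"
      using K1[OF that] by (simp add: prob_space)
    finally show "(\<integral>\<omega>. dist p (X 1 \<omega>) \<partial>P) \<le> K1 + 1" .
  qed
  define dev where "dev m P = {\<omega>\<in>space P. \<exists>n\<ge>m. \<epsilon> < dist (inductive_mean (\<lambda>i. X i \<omega>) n) (barycenter P (X 1))}" for m P
  \<comment> \<open>A supremum strictly exceeds \<epsilon> exactly when some member does, so the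
    event becomes existential.\<close>
  have dev: "{\<omega> \<in> space F. (\<Squnion>n\<in>{m..}. ennreal (dist (inductive_mean (\<lambda>i. X i \<omega>) n)
      (barycenter P (X 1)))) > ennreal \<epsilon>} = dev m P" if "P \<in> \<P>" for m P
    using sets_eq_imp_space_eq[OF sets_P[OF that]] \<open>\<epsilon> > 0\<close>
    by (auto simp: dev_def less_SUP_iff ennreal_less_iff)
  have bound: "\<exists>m0. \<forall>m\<ge>m0. \<forall>P\<in>\<P>. measure P (dev m P) \<le> \<eta>" if \<eta>: "\<eta> > 0" for \<eta> :: real
  proof -
    \<comment> \<open>The first bound keeps the barycenters within \<epsilon>/3, the second makes
      the maximal inequality contribute at most \<eta>/2.\<close>
    define \<delta> where "\<delta> = min (\<epsilon> / 6) (\<eta> * \<epsilon> / 6)"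
    have \<delta>: "\<delta> > 0" "6 * \<delta> \<le> \<epsilon>" "3 * \<delta> / \<epsilon> \<le> \<eta> / 2"
      using \<eta> \<open>\<epsilon> > 0\<close> by (auto simp: \<delta>_def field_simps min_def)
    \<comment> \<open>The lower bound 4(K1 + 1) ensures 4 E[d(p,X_1)] <= K for all measures at
      once.\<close>
    obtain K where K: "\<And>P. P \<in> \<P> \<Longrightarrow> (\<integral>\<omega>. dist (X 1 \<omega>) (truncate p K (X 1 \<omega>)) \<partial>P) \<le> \<delta>"
      and K_ge: "K \<ge> 4 * (K1 + 1)"
      using eventually_happens[OF eventually_conj[OF trunc[of \<delta>] eventually_ge_at_top[of "4 * (K1 + 1)"]]] \<delta>(1)
      by auto
    have "K > 0" and pos: "\<epsilon> / 3 > 0" "\<eta> / 2 > 0"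
      using K_ge \<open>K1 > 0\<close> \<eta> \<open>\<epsilon> > 0\<close> by auto
    obtain m0 :: nat where "m0 \<ge> 1" and m0:
      "\<And>(P :: 'w measure) X m. m \<ge> m0 \<Longrightarrow> prob_space P \<Longrightarrow> \<forall>i\<ge>1. X i \<in> borel_measurable P \<Longrightarrow> iid P X \<Longrightarrow>
        \<forall>i\<ge>1. \<forall>\<omega>. dist p (X i \<omega>) \<le> K \<Longrightarrow>
        measure P {\<omega>\<in>space P. \<exists>n\<ge>m. \<epsilon> / 3 < dist (inductive_mean (\<lambda>i. X i \<omega>) n) (barycenter P (X 1))} \<le> \<eta> / 2"
      using uniform_slln_inductive_mean_bounded[where q=p, OF pos \<open>K > 0\<close>] by blast
    have "measure P (dev m P) \<le> \<eta>" if "m \<ge> m0" "P \<in> \<P>" for m P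
    proof -
      have "measure P (dev m P) \<le> 3 * \<delta> / \<epsilon> + measure P {\<omega>\<in>space P. \<exists>n\<ge>m. \<epsilon> / 3 <
          dist (inductive_mean (\<lambda>i. truncate p K (X i \<omega>)) n) (barycenter P (\<lambda>\<omega>. truncate p K (X 1 \<omega>)))}"
        unfolding dev_def
      proof (rule prob_inductive_mean_deviation_le[OF P X iid moment(1) _ K \<delta>(2) \<open>\<epsilon> > 0\<close>])
        show "4 * (\<integral>\<omega>. dist p (X 1 \<omega>) \<partial>P) \<le> K"
          using moment(2)[OF \<open>P \<in> \<P>\<close>] K_ge by simp
      qed (use that \<open>m0 \<ge> 1\<close> in auto)
      also have "\<dots> \<le> 3 * \<delta> / \<epsilon> + \<eta> / 2"
      proof (intro add_left_mono m0)
        show "iid P (\<lambda>i \<omega>. truncate p K (X i \<omega>))"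
          by (rule iid_compose[OF P X iid]) (use that in auto)
        show "\<forall>i\<ge>1. (\<lambda>\<omega>. truncate p K (X i \<omega>)) \<in> borel_measurable P"
          using X[OF \<open>P \<in> \<P>\<close>] by (auto intro: measurable_compose[OF _ borel_measurable_truncate])
      qed (use that P \<open>K > 0\<close> in \<open>auto intro: dist_truncate_le\<close>)
      also have "\<dots> \<le> \<eta>"
        using \<delta>(3) by simp
      finally show ?thesis .
    qed
    then show ?thesis by blast
  qed
  show ?thesis
  proof (rule order_tendstoI)
    fix a :: ennreal assume "0 < a"
    \<comment> \<open>As \<open>a\<close> may be infinite, a real \<eta> strictly between 0 and
      \<open>a\<close> is chosen; the strict gap survives the supremum.\<close>
    then obtain \<eta> where \<eta>: "0 < ennreal \<eta>" "ennreal \<eta> < a"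
      by (metis dense ennreal_cases less_top_ennreal order_less_le_trans top_greatest)
    then have "\<eta> > 0" by simp
    from bound[OF this] obtain m0 where m0: "\<And>m P. m \<ge> m0 \<Longrightarrow> P \<in> \<P> \<Longrightarrow> measure P (dev m P) \<le> \<eta>"
      by blast
    have "(\<Squnion>P\<in>\<P>. emeasure P {\<omega> \<in> space F. (\<Squnion>n\<in>{m..}. ennreal (dist (inductive_mean (\<lambda>i. X i \<omega>) n)
        (barycenter P (X 1)))) > ennreal \<epsilon>}) < a" if "m \<ge> m0" for m
    proof (rule le_less_trans[OF SUP_least \<eta>(2)])
      fix P assume "P \<in> \<P>"
      interpret prob_space P by (rule P[OF \<open>P \<in> \<P>\<close>])
      show "emeasure P {\<omega> \<in> space F. (\<Squnion>n\<in>{m..}. ennreal (dist (inductive_mean (\<lambda>i. X i \<omega>) n)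
        (barycenter P (X 1)))) > ennreal \<epsilon>} \<le> ennreal \<eta>"
        unfolding dev[OF \<open>P \<in> \<P>\<close>] emeasure_eq_measure using m0[OF that \<open>P \<in> \<P>\<close>] by (rule ennreal_leI)
    qed
    then show "\<forall>\<^sub>F m in sequentially. (\<Squnion>P\<in>\<P>. emeasure P {\<omega> \<in> space F. (\<Squnion>n\<in>{m..}. ennreal (dist (inductive_mean (\<lambda>i. X i \<omega>) n)
        (barycenter P (X 1)))) > ennreal \<epsilon>}) < a"
      by (rule eventually_sequentiallyI)
  qed auto
qed

end
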